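(* Let $G$ be a connected quasi-threshold graph. Let $\mathbb Q$ be its set of maximal cliques, $\mathbb S$ its set of minimal vertex separators, and for $Q\in\mathbb Q$ let $\mathrm{Simp}(Q)$ be the set of simplicial vertices of $G$ lying in $Q$. Then the multiset of nonzero Laplacian eigenvalues of $G$ is exactly the multiset union of: (a) $d_G(v)+1$, taken once for each non-simplicial vertex $v$ of $G$; (b) $|Q|$, taken $|\mathrm{Simp}(Q)|-1$ times, for each $Q\in\mathbb Q$; (c) $|S|$, taken $\mu(S)$ times, for each $S\in\mathbb S$.
   Context: All graphs are finite, simple and undirected; $d_G(v)$ is the degree of $v$. The Laplacian matrix is $L(G)=D(G)-A(G)$ (diagonal degree matrix minus adjacency matrix). A graph is quasi-threshold if it contains neither $P_4$ nor $C_4$ as an induced subgraph (such graphs are chordal). A vertex is simplicial if its neighbourhood is a clique. A minimal vertex separator is a set $S$ which, for some non-adjacent $u,v$, separates $u$ from $v$ (they lie in different components of $G-S$) with no proper subset doing so. A clique tree of a chordal graph $G$ is a tree $T$ whose vertices are the maximal cliques of $G$ such that for any two maximal cliques $Q,Q'$, every clique on the $T$-path from $Q$ to $Q'$ contains $Q\cap Q'$. For a chordal graph, the minimal vertex separators are exactly the sets $Q\cap Q'$ for edges $\{Q,Q'\}$ of a clique tree, and the multiset $\{Q\cap Q' : \{Q,Q'\}\in E(T)\}$ is the same for every clique tree; the multiplicity $\mu(S)$ of $S\in\mathbb S$ is the number of times $S$ occurs in this multiset. *)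

theory Defs
  imports "Jordan_Normal_Form.Char_Poly" "HOL-Library.Multiset"
begin

definition simple_graph :: "nat \<Rightarrow> (nat \<Rightarrow> nat \<Rightarrow> bool) \<Rightarrow> bool" where
  "simple_graph n E \<longleftrightarrow> (\<forall>u v. E u v \<longrightarrow> u < n \<and> v < n) \<and>
     (\<forall>u v. E u v \<longrightarrow> E v u) \<and> (\<forall>v. \<not> E v v)"

definition verts :: "nat \<Rightarrow> nat set" where
  "verts n = {0..<n}"

definition degree :: "nat \<Rightarrow> (nat \<Rightarrow> nat \<Rightarrow> bool) \<Rightarrow> nat \<Rightarrow> nat" where
  "degree n E v = card {u \<in> verts n. E v u}"

definition laplacian :: "nat \<Rightarrow> (nat \<Rightarrow> nat \<Rightarrow> bool) \<Rightarrow> real mat" where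
  "laplacian n E = mat n n (\<lambda>(i, j). if i = j then real (degree n E i)
                                    else if E i j then -1 else 0)"

definition laplacian_spectrum :: "nat \<Rightarrow> (nat \<Rightarrow> nat \<Rightarrow> bool) \<Rightarrow> real multiset" where
  "laplacian_spectrum n E = proots (char_poly (laplacian n E))"

definition nonzero_laplacian_spectrum :: "nat \<Rightarrow> (nat \<Rightarrow> nat \<Rightarrow> bool) \<Rightarrow> real multiset" where
  "nonzero_laplacian_spectrum n E = filter_mset (\<lambda>x. x \<noteq> 0) (laplacian_spectrum n E)"

definition reachable_in :: "(nat \<Rightarrow> nat \<Rightarrow> bool) \<Rightarrow> nat set \<Rightarrow> nat \<Rightarrow> nat \<Rightarrow> bool" where
  "reachable_in E W u v \<longleftrightarrow> u \<in> W \<and> v \<in> W \<and> (\<lambda>x y. E x y \<and> x \<in> W \<and> y \<in> W)\<^sup>*\<^sup>* u v"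

definition connected_graph :: "nat \<Rightarrow> (nat \<Rightarrow> nat \<Rightarrow> bool) \<Rightarrow> bool" where
  "connected_graph n E \<longleftrightarrow> verts n \<noteq> {} \<and>
     (\<forall>u \<in> verts n. \<forall>v \<in> verts n. reachable_in E (verts n) u v)"

definition has_induced_P4 :: "nat \<Rightarrow> (nat \<Rightarrow> nat \<Rightarrow> bool) \<Rightarrow> bool" where
  "has_induced_P4 n E \<longleftrightarrow> (\<exists>a \<in> verts n. \<exists>b \<in> verts n. \<exists>c \<in> verts n. \<exists>d \<in> verts n.
      distinct [a, b, c, d] \<and> E a b \<and> E b c \<and> E c d \<and> \<not> E a c \<and> \<not> E b d \<and> \<not> E a d)"

definition has_induced_C4 :: "nat \<Rightarrow> (nat \<Rightarrow> nat \<Rightarrow> bool) \<Rightarrow> bool" where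
  "has_induced_C4 n E \<longleftrightarrow> (\<exists>a \<in> verts n. \<exists>b \<in> verts n. \<exists>c \<in> verts n. \<exists>d \<in> verts n.
      distinct [a, b, c, d] \<and> E a b \<and> E b c \<and> E c d \<and> E d a \<and> \<not> E a c \<and> \<not> E b d)"

definition quasi_threshold :: "nat \<Rightarrow> (nat \<Rightarrow> nat \<Rightarrow> bool) \<Rightarrow> bool" where
  "quasi_threshold n E \<longleftrightarrow> \<not> has_induced_P4 n E \<and> \<not> has_induced_C4 n E"

definition is_clique :: "nat \<Rightarrow> (nat \<Rightarrow> nat \<Rightarrow> bool) \<Rightarrow> nat set \<Rightarrow> bool" where
  "is_clique n E K \<longleftrightarrow> K \<subseteq> verts n \<and> (\<forall>x \<in> K. \<forall>y \<in> K. x \<noteq> y \<longrightarrow> E x y)"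

definition maximal_cliques :: "nat \<Rightarrow> (nat \<Rightarrow> nat \<Rightarrow> bool) \<Rightarrow> nat set set" where
  "maximal_cliques n E = {K. is_clique n E K \<and> (\<forall>K'. is_clique n E K' \<and> K \<subseteq> K' \<longrightarrow> K' = K)}"

definition simplicial :: "nat \<Rightarrow> (nat \<Rightarrow> nat \<Rightarrow> bool) \<Rightarrow> nat \<Rightarrow> bool" where
  "simplicial n E v \<longleftrightarrow> v \<in> verts n \<and> is_clique n E {u \<in> verts n. E v u}"

definition Simp :: "nat \<Rightarrow> (nat \<Rightarrow> nat \<Rightarrow> bool) \<Rightarrow> nat set \<Rightarrow> nat set" where
  "Simp n E Q = {v \<in> Q. simplicial n E v}"

definition separates :: "nat \<Rightarrow> (nat \<Rightarrow> nat \<Rightarrow> bool) \<Rightarrow> nat set \<Rightarrow> nat \<Rightarrow> nat \<Rightarrow> bool" where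
  "separates n E S u v \<longleftrightarrow> S \<subseteq> verts n \<and> u \<in> verts n - S \<and> v \<in> verts n - S \<and>
     \<not> reachable_in E (verts n - S) u v"

definition minimal_vertex_separators :: "nat \<Rightarrow> (nat \<Rightarrow> nat \<Rightarrow> bool) \<Rightarrow> nat set set" where
  "minimal_vertex_separators n E =
     {S. \<exists>u v. u \<noteq> v \<and> \<not> E u v \<and> separates n E S u v \<and>
               (\<forall>T. T \<subset> S \<longrightarrow> \<not> separates n E T u v)}"

definition is_path_in :: "'b set set \<Rightarrow> 'b list \<Rightarrow> bool" where
  "is_path_in T p \<longleftrightarrow> p \<noteq> [] \<and> distinct p \<and>
     (\<forall>i. Suc i < length p \<longrightarrow> {p ! i, p ! Suc i} \<in> T)"

definition is_tree :: "'b set \<Rightarrow> 'b set set \<Rightarrow> bool" where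
  "is_tree X T \<longleftrightarrow> finite X \<and> X \<noteq> {} \<and>
     (\<forall>e \<in> T. \<exists>x \<in> X. \<exists>y \<in> X. x \<noteq> y \<and> e = {x, y}) \<and>
     (\<forall>x \<in> X. \<forall>y \<in> X. \<exists>p. is_path_in T p \<and> hd p = x \<and> last p = y) \<and>
     \<not> (\<exists>c. is_path_in T c \<and> length c \<ge> 3 \<and> {last c, hd c} \<in> T)"

definition is_clique_tree :: "nat \<Rightarrow> (nat \<Rightarrow> nat \<Rightarrow> bool) \<Rightarrow> nat set set set \<Rightarrow> bool" where
  "is_clique_tree n E T \<longleftrightarrow> is_tree (maximal_cliques n E) T \<and>
     (\<forall>Q \<in> maximal_cliques n E. \<forall>Q' \<in> maximal_cliques n E. \<forall>p.
        is_path_in T p \<and> hd p = Q \<and> last p = Q' \<longrightarrow> (\<forall>R \<in> set p. Q \<inter> Q' \<subseteq> R))"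

text \<open>Multiplicity of a minimal separator S: number of edges {Q,Q'} of a clique
  tree with Q \<inter> Q' = S (independent of the chosen clique tree).\<close>
definition sep_mult :: "nat \<Rightarrow> (nat \<Rightarrow> nat \<Rightarrow> bool) \<Rightarrow> nat set \<Rightarrow> nat" where
  "sep_mult n E S = (let T = (SOME T. is_clique_tree n E T) in
     card {e \<in> T. \<exists>Q Q'. e = {Q, Q'} \<and> Q \<inter> Q' = S})"

end

theory Submission
  imports Defs
begin

text \<open>
  In a quasi-threshold graph adjacent vertices have nested closed neighbourhoods. Ordering vertices by
  inclusion of closed neighbourhoods (ties broken by index) therefore makes a connected one the
  comparability graph of a rooted tree. Let \<open>A v\<close> be the set of proper ancestors of \<open>v\<close>,
  \<open>U v = A v \<union> {v}\<close> and \<open>D v\<close> the set of descendants including \<open>v\<close>. The Laplacian maps the indicator of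
  \<open>D v\<close> to \<open>|A v| 1\<^bsub>D v\<^esub> - |D v| 1\<^bsub>A v\<^esub>\<close>, which yields a complete system of eigenvectors:
  \<^item> \<open>|D v| 1\<^bsub>{v}\<^esub> - 1\<^bsub>D v\<^esub>\<close> for \<open>v\<close> with a child, with eigenvalue \<open>|A v| + |D v| = d(v) + 1\<close>;
  \<^item> \<open>|D s| 1\<^bsub>D c\<^esub> - |D c| 1\<^bsub>D s\<^esub>\<close> for \<open>c\<close> a sibling of a chosen first child \<open>s\<close> of \<open>v\<close>, with eigenvalue
    \<open>|A c| = |U v|\<close>;
  \<^item> the all-ones vector, with eigenvalue 0.

  The maximal cliques are the sets \<open>U l\<close> for leaves \<open>l\<close>, and the simplicial vertices of \<open>U l\<close> form its
  bottom segment, so the first family splits into (a) and (b). In a clique tree the cliques containing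
  \<open>v\<close> span a subtree; comparing the numbers of edges of these subtrees for \<open>v\<close> and its children shows
  that \<open>U v\<close> occurs one time less than \<open>v\<close> has children, which is the second family.
\<close>

section \<open>Characteristic polynomials from eigenbases\<close>

text \<open>The \<open>f i\<close> are left eigenvectors; taken as rows of a matrix \<open>P\<close>
  they diagonalise \<open>A\<close> up to similarity once \<open>P\<close> is invertible. An index
  set of size \<open>n\<close> keeps repeated eigenvalues apart, so multiplicities come out without
  any discussion of eigenspaces.\<close>

lemma proots_char_poly_eigenbasis:
  fixes A :: "real mat" and f :: "'i \<Rightarrow> nat \<Rightarrow> real" and ev :: "'i \<Rightarrow> real"
  assumes A: "A \<in> carrier_mat n n" and I: "finite I" "card I = n"
    and eig: "\<And>i k. i \<in> I \<Longrightarrow> k < n \<Longrightarrow> (\<Sum>j<n. f i j * A $$ (j, k)) = ev i * f i k"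
    and inj: "\<And>x k. (\<And>i. i \<in> I \<Longrightarrow> (\<Sum>j<n. f i j * x j) = 0) \<Longrightarrow> k < n \<Longrightarrow> x k = 0"
  shows "proots (char_poly A) = image_mset ev (mset_set I)"
proof -
  obtain b where b: "bij_betw b {0..<n} I"
    using I ex_bij_betw_nat_finite by blast
  define P where "P = mat n n (\<lambda>(i, j). f (b i) j)"
  define \<Lambda> where "\<Lambda> = mat_diag n (\<lambda>i. ev (b i))"
  have P: "P \<in> carrier_mat n n" and \<Lambda>: "\<Lambda> \<in> carrier_mat n n"
    by (auto simp: P_def \<Lambda>_def)
  have bI: "b i \<in> I" if "i < n" for i
    using b that by (auto simp: bij_betw_def)
  have intertwine: "P * A = \<Lambda> * P"
  proof (rule eq_matI)
    fix i k assume "i < dim_row (\<Lambda> * P)" "k < dim_col (\<Lambda> * P)"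
    then have ik: "i < n" "k < n" using P \<Lambda> by auto
    have "(P * A) $$ (i, k) = (\<Sum>j<n. f (b i) j * A $$ (j, k))"
      using ik A by (simp add: P_def scalar_prod_def atLeast0LessThan)
    also have "\<dots> = ev (b i) * f (b i) k" using eig bI ik by blast
    also have "\<dots> = (\<Lambda> * P) $$ (i, k)"
      unfolding \<Lambda>_def mat_diag_mult_left[OF P] using ik by (simp add: P_def)
    finally show "(P * A) $$ (i, k) = (\<Lambda> * P) $$ (i, k)" .
  qed (use P A \<Lambda> in auto)
  \<comment> \<open>A kernel vector of \<open>P\<close> is annihilated by every \<open>f i\<close>,
    which is what \<open>inj\<close> rules out.\<close>
  have "det P \<noteq> 0"
  proof
    assume "det P = 0"
    then obtain v where v: "v \<in> carrier_vec n" "v \<noteq> 0\<^sub>v n" "P *\<^sub>v v = 0\<^sub>v n"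
      using det_0_iff_vec_prod_zero_field[OF P] by blast
    have orth: "(\<Sum>j<n. f i j * v $ j) = 0" if i: "i \<in> I" for i
    proof -
      obtain k where k: "k < n" "b k = i" using b i by (force simp: bij_betw_def)
      have "(P *\<^sub>v v) $ k = (\<Sum>j<n. f i j * v $ j)"
        using k v(1) by (simp add: P_def scalar_prod_def atLeast0LessThan)
      then show ?thesis using v(3) k by simp
    qed
    have "v = 0\<^sub>v n"
      using inj[of "\<lambda>j. v $ j", OF orth] v(1) by (intro eq_vecI) auto
    with v(2) show False by simp
  qed
  then obtain R where R: "R \<in> carrier_mat n n" "R * P = 1\<^sub>m n" "P * R = 1\<^sub>m n"
    using det_non_zero_imp_unit[OF P, of "()"] unfolding Units_def ring_mat_def by auto
  have "A = R * P * A" using R A by simp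
  also have "\<dots> = R * \<Lambda> * P"
    using R(1) P A \<Lambda> intertwine by (simp add: assoc_mult_mat[of _ n n _ n _ n])
  finally have "similar_mat A \<Lambda>"
    using R P A \<Lambda> by (intro similar_matI[of A \<Lambda> R P n]) auto
  then have "char_poly A = char_poly \<Lambda>" by (rule char_poly_similar)
  also have "\<dots> = (\<Prod>a \<leftarrow> diag_mat \<Lambda>. [:- a, 1:])"
    by (rule char_poly_upper_triangular[OF \<Lambda>]) (simp add: \<Lambda>_def mat_diag_def upper_triangular_def)
  also have "diag_mat \<Lambda> = map (\<lambda>i. ev (b i)) [0..<n]"
    by (auto simp: diag_mat_def \<Lambda>_def mat_diag_def)
  also have "(\<Prod>a \<leftarrow> \<dots>. [:- a, 1:]) = (\<Prod>i\<in>{0..<n}. [:- ev (b i), 1:])"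
    by (simp add: prod.distinct_set_conv_list[symmetric] comp_def)
  also have "\<dots> = (\<Prod>i\<in>I. [:- ev i, 1:])"
    by (rule prod.reindex_bij_betw[OF b])
  finally have "proots (char_poly A) = (\<Sum>i\<in>I. proots [:- ev i, 1:])"
    by (simp add: proots_prod)
  also have "\<dots> = image_mset ev (mset_set I)"
    using \<open>finite I\<close> by (induction I rule: finite_induct) simp_all
  finally show ?thesis .
qed

section \<open>Trees and junction trees\<close>

lemma finite_max_exists:
  fixes f :: "'a \<Rightarrow> nat"
  assumes "finite K" "K \<noteq> {}"
  obtains x where "x \<in> K" "\<And>y. y \<in> K \<Longrightarrow> f y \<le> f x"
proof -
  have "Max (f ` K) \<in> f ` K" using assms by (intro Max_in) auto
  then obtain x where "x \<in> K" "f x = Max (f ` K)" by force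
  then show thesis using that[of x] assms(1) by simp
qed

section \<open>Paths as lists of distinct vertices\<close>

lemma is_path_inD: "is_path_in T p \<Longrightarrow> Suc i < length p \<Longrightarrow> {p ! i, p ! Suc i} \<in> T"
  by (simp add: is_path_in_def)

lemma is_path_in_singleton [simp]: "is_path_in T [x]"
  by (simp add: is_path_in_def)

lemma is_path_in_Cons:
  assumes "p \<noteq> []"
  shows "is_path_in T (x # p) \<longleftrightarrow> is_path_in T p \<and> x \<notin> set p \<and> {x, hd p} \<in> T"
proof -
  have "(\<forall>i. Suc i < length (x # p) \<longrightarrow> {(x # p) ! i, (x # p) ! Suc i} \<in> T) \<longleftrightarrow>
    {x, hd p} \<in> T \<and> (\<forall>i. Suc i < length p \<longrightarrow> {p ! i, p ! Suc i} \<in> T)" (is "?l \<longleftrightarrow> ?r")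
  proof
    assume l: ?l
    have "{(x # p) ! 0, (x # p) ! Suc 0} \<in> T" using l[rule_format, of 0] assms by simp
    moreover have "{p ! i, p ! Suc i} \<in> T" if "Suc i < length p" for i
      using l[rule_format, of "Suc i"] that by simp
    ultimately show ?r using assms by (simp add: hd_conv_nth)
  next
    assume r: ?r
    show ?l
    proof (intro allI impI)
      fix i assume "Suc i < length (x # p)"
      then show "{(x # p) ! i, (x # p) ! Suc i} \<in> T"
        using r assms by (cases i) (auto simp: hd_conv_nth)
    qed
  qed
  then show ?thesis using assms by (auto simp: is_path_in_def)
qed

lemma is_path_in_rev [simp]: "is_path_in T (rev p) \<longleftrightarrow> is_path_in T p"
proof -
  have "is_path_in T (rev p)" if "is_path_in T p" for p
    unfolding is_path_in_def
  proof (intro conjI allI impI)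
    fix i assume i: "Suc i < length (rev p)"
    define j where "j = length p - Suc (Suc i)"
    have "Suc j < length p" "rev p ! i = p ! Suc j" "rev p ! Suc i = p ! j"
      using i by (auto simp: j_def rev_nth Suc_diff_Suc)
    then show "{rev p ! i, rev p ! Suc i} \<in> T"
      using is_path_inD[OF that, of j] by (simp add: insert_commute)
  qed (use that in \<open>auto simp: is_path_in_def\<close>)
  from this[of p] this[of "rev p"] show ?thesis by auto
qed

lemma is_path_in_mono: "is_path_in T p \<Longrightarrow> T \<subseteq> T' \<Longrightarrow> is_path_in T' p"
  by (auto simp: is_path_in_def)

lemma is_path_in_restrict:
  assumes "is_path_in T p" "set p \<subseteq> Y"
  shows "is_path_in {e \<in> T. e \<subseteq> Y} p"
  using assms by (auto simp: is_path_in_def dest: nth_mem)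

lemma is_path_in_take:
  "is_path_in T p \<Longrightarrow> 0 < k \<Longrightarrow> is_path_in T (take k p)"
  by (auto simp: is_path_in_def)

text \<open>An inner occurrence of a vertex on a path uses two different edges.\<close>

lemma pendant_on_path_end:
  assumes p: "is_path_in T p" and x: "x \<in> set p"
    and pendant: "\<And>e. e \<in> T \<Longrightarrow> x \<in> e \<Longrightarrow> e = {x, y}"
  shows "x = hd p \<or> x = last p"
proof (rule ccontr)
  assume "\<not> ?thesis"
  then have ne: "x \<noteq> hd p" "x \<noteq> last p" by auto
  obtain i where i: "i < length p" "p ! i = x" using x by (auto simp: in_set_conv_nth)
  have "p \<noteq> []" "distinct p" using p by (auto simp: is_path_in_def)
  have i0: "i \<noteq> 0" using ne i \<open>p \<noteq> []\<close> by (metis hd_conv_nth)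
  have iL: "Suc i < length p"
  proof (rule ccontr)
    assume "\<not> ?thesis"
    then have "i = length p - 1" using i by auto
    then show False using ne i \<open>p \<noteq> []\<close> by (metis last_conv_nth)
  qed
  obtain j where j: "i = Suc j" using i0 by (cases i) auto
  have "{p ! j, x} \<in> T" "{x, p ! Suc i} \<in> T"
    using is_path_inD[OF p, of j] is_path_inD[OF p, of i] i j iL by auto
  then have "{p ! j, x} = {x, y}" "{x, p ! Suc i} = {x, y}"
    using pendant by blast+
  moreover have "p ! j \<noteq> x" "p ! Suc i \<noteq> x" "p ! j \<noteq> p ! Suc i"
    using \<open>distinct p\<close> i j iL by (auto simp: nth_eq_iff_index_eq)
  ultimately show False by (auto simp: doubleton_eq_iff)
qed

section \<open>Finite trees: subtrees, pendant vertices, number of edges\<close>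

lemma is_tree_edgeE:
  assumes "is_tree X T" "e \<in> T"
  obtains x y where "x \<in> X" "y \<in> X" "x \<noteq> y" "e = {x, y}"
  using assms unfolding is_tree_def by blast

lemma is_tree_edge_subset: "is_tree X T \<Longrightarrow> e \<in> T \<Longrightarrow> e \<subseteq> X"
  by (erule is_tree_edgeE) auto

lemma is_tree_finite_edges:
  assumes "is_tree X T" shows "finite T"
proof (rule finite_subset)
  show "T \<subseteq> Pow X" using is_tree_edge_subset[OF assms] by blast
  show "finite (Pow X)" using assms by (simp add: is_tree_def)
qed

lemma is_tree_path:
  assumes "is_tree X T" "x \<in> X" "y \<in> X"
  obtains p where "is_path_in T p" "hd p = x" "last p = y"
  using assms unfolding is_tree_def by blast

text \<open>A one-element list is a path for every \<open>T\<close>, even if its vertex lies outside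
  \<open>X\<close>. With at least two vertices, each vertex lies on an edge.\<close>

lemma is_path_in_subset:
  assumes "\<And>e. e \<in> T \<Longrightarrow> e \<subseteq> X" "is_path_in T p" "length p \<ge> 2"
  shows "set p \<subseteq> X"
proof
  fix x assume "x \<in> set p"
  then obtain i where i: "i < length p" "p ! i = x" by (auto simp: in_set_conv_nth)
  show "x \<in> X"
  proof (cases i)
    case 0
    then show ?thesis
      using assms(1)[OF is_path_inD[OF assms(2), of 0]] i assms(3) by auto
  next
    case (Suc j)
    then show ?thesis
      using assms(1)[OF is_path_inD[OF assms(2), of j]] i by auto
  qed
qed

lemma is_path_in_subset_hd:
  assumes T: "\<And>e. e \<in> T \<Longrightarrow> e \<subseteq> X" and p: "is_path_in T p" and "hd p \<in> X"
  shows "set p \<subseteq> X"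
proof (cases "length p \<ge> 2")
  case True
  then show ?thesis using is_path_in_subset[OF T p] by blast
next
  case False
  then have "length p = 1" using p by (cases p) (auto simp: is_path_in_def Suc_le_eq)
  then show ?thesis using \<open>hd p \<in> X\<close> by (cases p) auto
qed

text \<open>A path-convex set of vertices spans a subtree: \<open>closed\<close> keeps the
  connecting paths inside \<open>Y\<close>, and a cycle in \<open>Y\<close> would be a cycle of
  \<open>T\<close>. It serves both for deleting a pendant vertex and for the cliques through a fixed
  vertex.\<close>

lemma is_tree_restrict:
  assumes tree: "is_tree X T" and Y: "Y \<subseteq> X" "Y \<noteq> {}"
    and closed: "\<And>p. is_path_in T p \<Longrightarrow> hd p \<in> Y \<Longrightarrow> last p \<in> Y \<Longrightarrow> set p \<subseteq> Y"
  shows "is_tree Y {e \<in> T. e \<subseteq> Y}"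
  unfolding is_tree_def
proof (intro conjI)
  show "finite Y" using tree Y by (auto simp: is_tree_def intro: finite_subset)
  show "\<forall>e\<in>{e \<in> T. e \<subseteq> Y}. \<exists>x\<in>Y. \<exists>y\<in>Y. x \<noteq> y \<and> e = {x, y}"
  proof
    fix e assume e: "e \<in> {e \<in> T. e \<subseteq> Y}"
    then obtain x y where "x \<noteq> y" "e = {x, y}" using is_tree_edgeE[OF tree] by blast
    then show "\<exists>x\<in>Y. \<exists>y\<in>Y. x \<noteq> y \<and> e = {x, y}" using e by blast
  qed
  show "\<forall>x\<in>Y. \<forall>y\<in>Y. \<exists>p. is_path_in {e \<in> T. e \<subseteq> Y} p \<and> hd p = x \<and> last p = y"
  proof (intro ballI)
    fix x y assume "x \<in> Y" "y \<in> Y"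
    then obtain p where "is_path_in T p" "hd p = x" "last p = y"
      using is_tree_path[OF tree, of x y] Y by blast
    then show "\<exists>p. is_path_in {e \<in> T. e \<subseteq> Y} p \<and> hd p = x \<and> last p = y"
      using is_path_in_restrict closed \<open>x \<in> Y\<close> \<open>y \<in> Y\<close> by metis
  qed
  show "\<not> (\<exists>c. is_path_in {e \<in> T. e \<subseteq> Y} c \<and> 3 \<le> length c \<and> {last c, hd c} \<in> {e \<in> T. e \<subseteq> Y})"
    using tree is_path_in_mono[of "{e \<in> T. e \<subseteq> Y}" _ T] unfolding is_tree_def by blast
qed (use Y in auto)

text \<open>Take a longest path with at least two vertices; it exists because a path in
  \<open>X\<close> has at most \<open>card X\<close> vertices. A further neighbour of its first
  vertex would either prolong the path or close a cycle.\<close>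

lemma is_tree_pendant_exists:
  assumes tree: "is_tree X T" and "card X \<ge> 2"
  obtains x y where "x \<in> X" "y \<in> X" "x \<noteq> y" "{x, y} \<in> T"
    "\<And>e. e \<in> T \<Longrightarrow> x \<in> e \<Longrightarrow> e = {x, y}"
proof -
  have fin: "finite X" using tree by (simp add: is_tree_def)
  have sub: "\<And>e. e \<in> T \<Longrightarrow> e \<subseteq> X" by (rule is_tree_edge_subset[OF tree])
  obtain a b where ab: "a \<in> X" "b \<in> X" "a \<noteq> b"
    using \<open>card X \<ge> 2\<close> card_le_Suc0_iff_eq[OF fin] by fastforce
  let ?Ps = "{p. is_path_in T p \<and> length p \<ge> 2}"
  obtain p0 where p0: "is_path_in T p0" "hd p0 = a" "last p0 = b"
    using is_tree_path[OF tree ab(1,2)] by blast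
  have "length p0 \<ge> 2"
  proof (rule ccontr)
    assume "\<not> ?thesis"
    then obtain z where "p0 = [z]" using p0(1) by (cases p0) (auto simp: is_path_in_def Suc_le_eq)
    then show False using p0 ab by auto
  qed
  then have ex: "p0 \<in> ?Ps" using p0 by simp
  have bound: "length p \<le> card X" if "p \<in> ?Ps" for p
    using that is_path_in_subset[OF sub, where p = p] distinct_card[of p] card_mono[OF fin]
    by (metis is_path_in_def mem_Collect_eq)
  obtain p where p: "p \<in> ?Ps" and longest: "\<And>q. q \<in> ?Ps \<Longrightarrow> length q \<le> length p"
    using ex_has_greatest_nat[of "\<lambda>p. p \<in> ?Ps" p0 length "Suc (card X)"] ex bound
    by (metis less_Suc_eq_le)
  obtain x y q where pq: "p = x # y # q"
    using p by (cases p; cases "tl p") auto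
  have pT: "is_path_in T p" using p by simp
  have "set p \<subseteq> X" using is_path_in_subset[OF sub, where p = p] p by blast
  have xy: "x \<noteq> y" "x \<in> X" "y \<in> X" "{x, y} \<in> T"
    using pT pq \<open>set p \<subseteq> X\<close> is_path_inD[OF pT, of 0] by (auto simp: is_path_in_def)
  have "e = {x, y}" if e: "e \<in> T" "x \<in> e" for e
  proof -
    obtain z where z: "e = {x, z}" "z \<noteq> x"
      using is_tree_edgeE[OF tree e(1)] e(2) by (metis empty_iff insert_commute insert_iff)
    have "z \<in> set p"
    proof (rule ccontr)
      assume "z \<notin> set p"
      then have "is_path_in T (z # p)"
        using pT pq e z by (subst is_path_in_Cons) (auto simp: insert_commute)
      then show False using longest[of "z # p"] p by simp
    qed
    then obtain i where i: "i < length p" "p ! i = z" by (auto simp: in_set_conv_nth)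
    consider "i = 0" | "i = 1" | "i \<ge> 2" by linarith
    then show ?thesis
    proof cases
      case 1
      then show ?thesis using i z pq by simp
    next
      case 2
      then show ?thesis using i z pq by simp
    next
      case 3
      \<comment> \<open>The initial segment from \<open>x\<close> to \<open>z\<close> has at least
        three vertices, and the edge \<open>e\<close> closes it to a cycle.\<close>
      let ?c = "take (Suc i) p"
      have "is_path_in T ?c" using is_path_in_take[OF pT] by simp
      moreover have "length ?c \<ge> 3" using 3 i by simp
      moreover have "?c = take i p @ [z]"
        using i by (simp add: take_Suc_conv_app_nth)
      then have "last ?c = z" by simp
      moreover have "hd ?c = x" using pq by simp
      ultimately show ?thesis
        using tree e z unfolding is_tree_def by (metis insert_commute)
    qed
  qed
  then show ?thesis using that xy by blast
qed

text \<open>Induction on the number of vertices: deleting a pendant vertex removes exactly one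
  edge.\<close>

lemma is_tree_card_edges:
  assumes "is_tree X T" shows "Suc (card T) = card X"
  using assms
proof (induction "card X" arbitrary: X T rule: less_induct)
  case less
  have fin: "finite X" and "X \<noteq> {}" using less.prems by (auto simp: is_tree_def)
  show ?case
  proof (cases "card X \<ge> 2")
    case False
    moreover have "card X > 0" using fin \<open>X \<noteq> {}\<close> by (simp add: card_gt_0_iff)
    ultimately have "card X = 1" by linarith
    then obtain x where "X = {x}" by (auto simp: card_1_singleton_iff)
    then have "T = {}"
      using is_tree_edgeE[OF less.prems] by (metis equals0I singletonD)
    then show ?thesis using \<open>card X = 1\<close> by simp
  next
    case True
    obtain x y where xy: "x \<in> X" "y \<in> X" "x \<noteq> y" "{x, y} \<in> T"
      and pendant: "\<And>e. e \<in> T \<Longrightarrow> x \<in> e \<Longrightarrow> e = {x, y}"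
      using is_tree_pendant_exists[OF less.prems True] by blast
    let ?Y = "X - {x}"
    have "set p \<subseteq> ?Y" if "is_path_in T p" "hd p \<in> ?Y" "last p \<in> ?Y" for p
      using pendant_on_path_end[OF that(1) _ pendant]
        is_path_in_subset_hd[OF is_tree_edge_subset[OF less.prems] that(1)] that(2,3) by blast
    then have tree: "is_tree ?Y {e \<in> T. e \<subseteq> ?Y}"
      using xy by (intro is_tree_restrict[OF less.prems]) auto
    have "card ?Y < card X" using fin xy(1) by (rule card_Diff1_less)
    from less.hyps[OF this tree] have "Suc (card {e \<in> T. e \<subseteq> ?Y}) = card ?Y" .
    moreover have "T = insert {x, y} {e \<in> T. e \<subseteq> ?Y}"
    proof
      show "T \<subseteq> insert {x, y} {e \<in> T. e \<subseteq> ?Y}"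
      proof
        fix e assume "e \<in> T"
        then show "e \<in> insert {x, y} {e \<in> T. e \<subseteq> ?Y}"
          using pendant[of e] is_tree_edge_subset[OF less.prems, of e] by (cases "x \<in> e") auto
      qed
    qed (use xy in auto)
    moreover have "{x, y} \<notin> {e \<in> T. e \<subseteq> ?Y}" by auto
    moreover have "finite {e \<in> T. e \<subseteq> ?Y}" using is_tree_finite_edges[OF tree] .
    ultimately have "card T = Suc (card {e \<in> T. e \<subseteq> ?Y})" by (metis card_insert_disjoint)
    then show ?thesis
      using \<open>Suc (card {e \<in> T. e \<subseteq> ?Y}) = card ?Y\<close> xy fin
      by (metis card_Suc_Diff1)
  qed
qed

text \<open>The two path statements reduce the paths of the enlarged tree to those of
  \<open>T\<close>, which is how the running intersection property will survive the insertion of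
  \<open>x\<close>.\<close>

lemma is_tree_insert_pendant:
  assumes tree: "is_tree X T" and x: "x \<notin> X" and y: "y \<in> X"
  shows "is_tree (insert x X) (insert {x, y} T)"
    and "\<And>p. is_path_in (insert {x, y} T) p \<Longrightarrow> x \<notin> set p \<Longrightarrow> is_path_in T p"
    and "\<And>p. is_path_in (insert {x, y} T) p \<Longrightarrow> hd p = x \<Longrightarrow> last p \<noteq> x \<Longrightarrow>
      \<exists>q. p = x # q \<and> is_path_in T q \<and> hd q = y"
proof -
  let ?T = "insert {x, y} T"
  have sub: "\<And>e. e \<in> T \<Longrightarrow> e \<subseteq> X" by (rule is_tree_edge_subset[OF tree])
  have xT: "x \<notin> e" if "e \<in> T" for e using sub that x by blast
  have pendant: "\<And>e. e \<in> ?T \<Longrightarrow> x \<in> e \<Longrightarrow> e = {x, y}" using xT by blast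
  show old: "is_path_in T p" if "is_path_in ?T p" "x \<notin> set p" for p
    using is_path_in_restrict[OF that(1), of "- {x}"] that(2)
    by (rule_tac is_path_in_mono[of "{e \<in> ?T. e \<subseteq> - {x}}"]) auto
  show new: "\<exists>q. p = x # q \<and> is_path_in T q \<and> hd q = y"
    if p: "is_path_in ?T p" "hd p = x" "last p \<noteq> x" for p
  proof -
    obtain q where q: "p = x # q" using p by (cases p) (auto simp: is_path_in_def)
    have "q \<noteq> []" using p q by auto
    then have *: "is_path_in ?T q" "x \<notin> set q" "{x, hd q} \<in> ?T"
      using p(1) unfolding q by (simp_all add: is_path_in_Cons)
    then have "{x, hd q} = {x, y}" using pendant by blast
    then have "hd q = y" by (metis \<open>q \<noteq> []\<close> * doubleton_eq_iff)
    then show ?thesis using q old * by blast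
  qed
  have from_x: "\<exists>p. is_path_in ?T p \<and> hd p = x \<and> last p = z" if z: "z \<in> X" for z
  proof -
    obtain q where q: "is_path_in T q" "hd q = y" "last q = z"
      using is_tree_path[OF tree y z] by blast
    have "set q \<subseteq> X" using is_path_in_subset_hd[OF sub q(1)] q y by blast
    moreover have "q \<noteq> []" using q by (simp add: is_path_in_def)
    ultimately have "is_path_in ?T (x # q)"
      using x q is_path_in_mono[OF q(1), of ?T] by (auto simp: is_path_in_Cons)
    then show ?thesis using q \<open>q \<noteq> []\<close> by (intro exI[of _ "x # q"]) auto
  qed
  show "is_tree (insert x X) ?T"
    unfolding is_tree_def
  proof (intro conjI)
    show "finite (insert x X)" using tree by (simp add: is_tree_def)
    show "\<forall>e\<in>?T. \<exists>a\<in>insert x X. \<exists>b\<in>insert x X. a \<noteq> b \<and> e = {a, b}"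
    proof
      fix e assume "e \<in> ?T"
      then consider "e = {x, y}" | "e \<in> T" by blast
      then show "\<exists>a\<in>insert x X. \<exists>b\<in>insert x X. a \<noteq> b \<and> e = {a, b}"
      proof cases
        case 1
        moreover have "x \<noteq> y" using x y by blast
        ultimately show ?thesis using y by blast
      next
        case 2
        then show ?thesis using is_tree_edgeE[OF tree] by (metis insertCI)
      qed
    qed
    show "\<forall>a\<in>insert x X. \<forall>b\<in>insert x X. \<exists>p. is_path_in ?T p \<and> hd p = a \<and> last p = b"
    proof (intro ballI)
      fix a b assume ab: "a \<in> insert x X" "b \<in> insert x X"
      consider "a = x" "b = x" | "a = x" "b \<in> X" | "a \<in> X" "b = x" | "a \<in> X" "b \<in> X"
        using ab by blast
      then show "\<exists>p. is_path_in ?T p \<and> hd p = a \<and> last p = b"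
      proof cases
        case 1
        then show ?thesis by (intro exI[of _ "[x]"]) simp
      next
        case 2
        then show ?thesis using from_x by blast
      next
        case 3
        then obtain p where "is_path_in ?T p" "hd p = x" "last p = a" using from_x by blast
        then show ?thesis
          using 3 by (intro exI[of _ "rev p"]) (simp add: hd_rev last_rev)
      next
        case 4
        then show ?thesis
          using is_tree_path[OF tree] is_path_in_mono[of T _ ?T] by (metis subset_insertI)
      qed
    qed
    show "\<not> (\<exists>c. is_path_in ?T c \<and> 3 \<le> length c \<and> {last c, hd c} \<in> ?T)"
    proof
      assume "\<exists>c. is_path_in ?T c \<and> 3 \<le> length c \<and> {last c, hd c} \<in> ?T"
      then obtain c where c: "is_path_in ?T c" "3 \<le> length c" "{last c, hd c} \<in> ?T" by blast
      \<comment> \<open>A cycle listed from \<open>x\<close> would have \<open>y\<close> as its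
        second and also as its last vertex, since \<open>{x, y}\<close> is the only edge at
        \<open>x\<close>; it would then have length two.\<close>
      have no: False if c: "is_path_in ?T c" "3 \<le> length c" "{last c, hd c} \<in> ?T" "hd c = x" for c
      proof -
        have dist: "distinct c" using c by (simp add: is_path_in_def)
        have ne: "last c \<noteq> x" using c dist by (cases c) auto
        then obtain q where q: "c = x # q" "is_path_in T q" "hd q = y" using new c by blast
        have "last c = y" using pendant[OF c(3)] c(4) ne by (auto simp: doubleton_eq_iff)
        then show False using q c(2) dist by (cases q) (auto split: if_splits)
      qed
      show False
      proof (cases "x \<in> set c")
        case True
        then consider "hd c = x" | "last c = x" using pendant_on_path_end[OF c(1) True pendant] by blast
        then show False
        proof cases
          case 1
          then show False using no c by blast
        next
          case 2
          then show False
            using no[of "rev c"] c by (simp add: hd_rev last_rev insert_commute)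
        qed
      next
        case False
        then have "is_path_in T c" using old c by blast
        moreover have "{last c, hd c} \<in> T"
        proof -
          have "c \<noteq> []" using c(2) by auto
          then have "last c \<noteq> x" "hd c \<noteq> x" using False by (metis last_in_set, metis hd_in_set)
          then show ?thesis using c(3) by (auto simp: doubleton_eq_iff)
        qed
        ultimately show False using tree c(2) unfolding is_tree_def by blast
      qed
    qed
  qed simp
qed

text \<open>If for each member the intersections with the others form a chain, then any insertion order
  has the running intersection property: attach the new member to one with the largest intersection.\<close>

lemma junction_tree_exists:
  assumes "finite X" "X \<noteq> {}"
    and "\<And>Q. Q \<in> X \<Longrightarrow> finite Q"
    and "\<And>Q Q1 Q2. Q \<in> X \<Longrightarrow> Q1 \<in> X \<Longrightarrow> Q2 \<in> X \<Longrightarrow> Q \<inter> Q1 \<subseteq> Q \<inter> Q2 \<or> Q \<inter> Q2 \<subseteq> Q \<inter> Q1"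
  shows "\<exists>T. is_tree X T \<and> (\<forall>p. is_path_in T p \<and> hd p \<in> X \<and> last p \<in> X \<longrightarrow>
    (\<forall>R\<in>set p. hd p \<inter> last p \<subseteq> R))"
  using assms
proof (induction X rule: finite_ne_induct)
  case (singleton x)
  have "is_tree {x} {}"
    unfolding is_tree_def by (auto intro!: exI[of _ "[x]"])
  moreover have "\<forall>R\<in>set p. hd p \<inter> last p \<subseteq> R" if "is_path_in {} p" for p :: "'a set list"
    using that by (cases p; cases "tl p") (auto simp: is_path_in_Cons)
  ultimately show ?case by blast
next
  case (insert x X)
  have chain: "x \<inter> Q1 \<subseteq> x \<inter> Q2 \<or> x \<inter> Q2 \<subseteq> x \<inter> Q1" if "Q1 \<in> X" "Q2 \<in> X" for Q1 Q2
    using insert.prems(2)[of x Q1 Q2] that by simp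
  obtain T where tree: "is_tree X T"
    and junction: "\<And>p R. is_path_in T p \<Longrightarrow> hd p \<in> X \<Longrightarrow> last p \<in> X \<Longrightarrow> R \<in> set p \<Longrightarrow> hd p \<inter> last p \<subseteq> R"
    using insert.IH insert.prems by (metis insertCI)
  obtain y where y: "y \<in> X" and y_max: "\<And>z. z \<in> X \<Longrightarrow> card (x \<inter> z) \<le> card (x \<inter> y)"
    using finite_max_exists[OF insert.hyps(1,2), of "\<lambda>z. card (x \<inter> z)"] by blast
  have fin: "finite x" using insert.prems(1) by blast
  \<comment> \<open>The sets \<open>x \<inter> z\<close> form a chain, so the one of largest
    cardinality contains all others.\<close>
  have big: "x \<inter> z \<subseteq> y" if "z \<in> X" for z
  proof (cases "x \<inter> z \<subseteq> x \<inter> y")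
    case False
    then have "x \<inter> y \<subset> x \<inter> z" using chain[OF that y] by blast
    then have "card (x \<inter> y) < card (x \<inter> z)" using fin by (intro psubset_card_mono) auto
    then show ?thesis using y_max[OF that] by simp
  qed blast
  let ?T = "insert {x, y} T"
  note pend = is_tree_insert_pendant[OF tree insert.hyps(3) y]
  \<comment> \<open>A path leaving \<open>x\<close> passes through \<open>y\<close>; by
    \<open>big\<close> the elements common to \<open>x\<close> and the last set lie in
    \<open>y\<close>, so the old property applies from \<open>y\<close> onwards.\<close>
  have from_x: "hd p \<inter> last p \<subseteq> R"
    if p: "is_path_in ?T p" "hd p = x" "last p \<in> X" "R \<in> set p" for p R
  proof -
    have "last p \<noteq> x" using p insert.hyps(3) by auto
    then obtain q where q: "p = x # q" "is_path_in T q" "hd q = y" using pend(3) p by blast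
    have "q \<noteq> []" using q by (simp add: is_path_in_def)
    then have l: "last p = last q" using q by simp
    show ?thesis
    proof (cases "R = x")
      case False
      then have "hd q \<inter> last q \<subseteq> R" using junction[OF q(2)] q y p l by auto
      then show ?thesis using big[OF p(3)] l q p by auto
    qed (use q in auto)
  qed
  have "hd p \<inter> last p \<subseteq> R"
    if p: "is_path_in ?T p" "hd p \<in> insert x X" "last p \<in> insert x X" "R \<in> set p" for p R
  proof -
    have ne: "p \<noteq> []" "distinct p" using p by (auto simp: is_path_in_def)
    consider "hd p = x" "last p = x" | "hd p = x" "last p \<in> X" | "hd p \<in> X" "last p = x"
      | "hd p \<in> X" "last p \<in> X" using p by blast
    then show ?thesis
    proof cases
      case 1
      then have "p = [x]" using ne by (cases p) (auto split: if_splits)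
      then show ?thesis using p by simp
    next
      case 2
      then show ?thesis using from_x p by blast
    next
      case 3
      then show ?thesis using from_x[of "rev p" R] p by (auto simp: hd_rev last_rev)
    next
      case 4
      \<comment> \<open>The pendant vertex could only be an end of the path, and here both ends lie
        in \<open>X\<close>.\<close>
      have "x \<notin> set p"
      proof
        assume "x \<in> set p"
        from pendant_on_path_end[OF p(1) this, of y]
        show False using 4 insert.hyps(3) is_tree_edge_subset[OF tree] by blast
      qed
      then show ?thesis using junction[OF pend(2)[OF p(1)]] 4 p by blast
    qed
  qed
  then show ?case using pend(1) by blast
qed

section \<open>Comparability graphs of rooted trees\<close>

lemma image_mset_mset_set_sum:
  "finite S \<Longrightarrow> image_mset f (mset_set S) = (\<Sum>x\<in>S. {#f x#})"
  by (induction S rule: finite_induct) simp_all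

lemma sum_singleton_mset_const:
  assumes "finite S" "\<And>x. x \<in> S \<Longrightarrow> f x = a"
  shows "(\<Sum>x\<in>S. {#f x#}) = replicate_mset (card S) a"
  using assms by (induction S rule: finite_induct) simp_all

lemma sum_scaled_diff:
  fixes p q h :: "'a \<Rightarrow> real"
  shows "(\<Sum>j\<in>S. (a * p j - b * q j) * h j) = a * (\<Sum>j\<in>S. p j * h j) - b * (\<Sum>j\<in>S. q j * h j)"
  by (simp add: sum_distrib_left sum_subtractf[symmetric] left_diff_distrib mult.assoc)

text \<open>A connected quasi-threshold graph is the comparability graph of a rooted forest order with one
  root; \<open>anc u v\<close> says that \<open>u\<close> is a proper ancestor of \<open>v\<close>.\<close>

locale tree_order =
  fixes n :: nat and E anc :: "nat \<Rightarrow> nat \<Rightarrow> bool" and r :: nat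
  assumes anc_less: "anc u v \<Longrightarrow> u < n \<and> v < n"
    and anc_irrefl [simp]: "\<not> anc v v"
    and anc_trans: "anc u v \<Longrightarrow> anc v w \<Longrightarrow> anc u w"
    and anc_chain: "anc a v \<Longrightarrow> anc b v \<Longrightarrow> a = b \<or> anc a b \<or> anc b a"
    and root_less: "r < n"
    and root_anc: "v < n \<Longrightarrow> v \<noteq> r \<Longrightarrow> anc r v"
    and E_iff: "E u v \<longleftrightarrow> anc u v \<or> anc v u"
begin

definition A :: "nat \<Rightarrow> nat set" where "A v = {u. anc u v}"
definition U :: "nat \<Rightarrow> nat set" where "U v = insert v (A v)"
definition D :: "nat \<Rightarrow> nat set" where "D v = insert v {w. anc v w}"
text \<open>Parenthood expressed through ancestor sets: \<open>v\<close> is the deepest proper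
  ancestor of \<open>c\<close>. Siblings then visibly share their ancestors.\<close>

definition children :: "nat \<Rightarrow> nat set" where "children v = {c. A c = U v}"
definition internal :: "nat set" where "internal = {v. v < n \<and> children v \<noteq> {}}"
definition leaves :: "nat set" where "leaves = {v. v < n \<and> children v = {}}"

section \<open>Ancestors, descendants and children\<close>

lemma anc_asym: "anc u v \<Longrightarrow> \<not> anc v u"
  using anc_trans anc_irrefl by blast

lemma in_A [simp]: "u \<in> A v \<longleftrightarrow> anc u v" by (simp add: A_def)
lemma in_U [simp]: "u \<in> U v \<longleftrightarrow> u = v \<or> anc u v" by (simp add: U_def)
lemma in_D [simp]: "w \<in> D v \<longleftrightarrow> w = v \<or> anc v w" by (simp add: D_def)

lemma A_subset: "A v \<subseteq> {..<n}" using anc_less by auto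
lemma finite_A [simp]: "finite (A v)" using A_subset finite_subset by blast
lemma finite_U [simp]: "finite (U v)" by (simp add: U_def)
lemma finite_D [simp]: "finite (D v)"
proof -
  have "D v \<subseteq> insert v {..<n}" using anc_less by auto
  then show ?thesis using finite_subset by blast
qed

lemma card_D_pos: "card (D v) > 0"
  by (metis card_gt_0_iff empty_iff finite_D in_D)

lemma child_anc: "c \<in> children v \<Longrightarrow> anc v c"
proof -
  assume "c \<in> children v"
  then have "A c = U v" by (simp add: children_def)
  moreover have "v \<in> U v" by simp
  ultimately have "v \<in> A c" by blast
  then show ?thesis by simp
qed

lemma child_less: "c \<in> children v \<Longrightarrow> c < n" "c \<in> children v \<Longrightarrow> v < n"
  using child_anc anc_less by blast+

lemma finite_children [simp]: "finite (children v)"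
proof (rule finite_subset)
  show "children v \<subseteq> {..<n}" using child_less by auto
qed simp

lemma finite_internal [simp]: "finite internal" and finite_leaves [simp]: "finite leaves"
  by (auto simp: internal_def leaves_def)

text \<open>\<open>card (A v)\<close> is the depth of \<open>v\<close>, the measure behind the
  extremal choices and the induction from the root downwards.\<close>

lemma card_A_less: "anc u v \<Longrightarrow> card (A u) < card (A v)"
proof (rule psubset_card_mono)
  assume "anc u v"
  then have "A u \<subseteq> A v" "u \<in> A v - A u" using anc_trans by auto
  then show "A u \<subset> A v" by blast
qed simp

text \<open>On the chain strictly below \<open>v\<close> and down to \<open>w\<close>, the vertex of
  least depth has nothing between itself and \<open>v\<close>, so it is a child of
  \<open>v\<close>.\<close>

lemma child_above_exists:
  assumes "anc v w"
  shows "\<exists>c\<in>children v. w \<in> D c"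
proof -
  define C where "C = {c. anc v c \<and> w \<in> D c}"
  have "w \<in> C" using assms by (simp add: C_def)
  then obtain c where c: "c \<in> C" and least: "\<And>a. a \<in> C \<Longrightarrow> card (A c) \<le> card (A a)"
    using ex_has_least_nat[of "\<lambda>c. c \<in> C" w "\<lambda>a. card (A a)"] by blast
  have "a = v \<or> anc a v" if a: "anc a c" for a
  proof (rule ccontr)
    assume "\<not> ?thesis"
    then have "anc v a" using anc_chain[OF a, of v] c by (auto simp: C_def)
    moreover have "anc a w" using a c anc_trans by (auto simp: C_def)
    ultimately have "a \<in> C" by (simp add: C_def)
    then show False using least card_A_less[OF a] by (simp add: leD)
  qed
  moreover have "anc a c" if "a = v \<or> anc a v" for a
    using that c anc_trans by (auto simp: C_def)
  ultimately have "A c = U v" by auto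
  then show ?thesis using c by (auto simp: children_def C_def)
qed

lemma parent_exists:
  assumes "c < n" "c \<noteq> r"
  shows "\<exists>v. c \<in> children v"
proof -
  have "A c \<noteq> {}" using root_anc[OF assms] by auto
  then obtain v where v: "v \<in> A c" and greatest: "\<And>a. a \<in> A c \<Longrightarrow> card (A a) \<le> card (A v)"
    using finite_max_exists[OF finite_A, of c "\<lambda>a. card (A a)"] by blast
  have "a = v \<or> anc a v" if a: "anc a c" for a
  proof (rule ccontr)
    assume "\<not> ?thesis"
    then have "anc v a" using anc_chain[OF a, of v] v by auto
    then show False using greatest[of a] a card_A_less by fastforce
  qed
  moreover have "anc a c" if "a = v \<or> anc a v" for a
    using that v anc_trans by auto
  ultimately have "A c = U v" by auto
  then show ?thesis by (auto simp: children_def)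
qed

lemma inj_U: "U v = U w \<Longrightarrow> v = w"
  by (metis anc_asym in_U)

lemma parent_unique: "c \<in> children v \<Longrightarrow> c \<in> children w \<Longrightarrow> v = w"
  by (rule inj_U) (simp add: children_def)

lemma siblings_incomparable:
  assumes "c \<in> children v" "d \<in> children v" shows "\<not> anc c d"
proof -
  have "A c = A d" using assms by (simp add: children_def)
  then have "c \<notin> A d" using in_A[of c c] by simp
  then show ?thesis by simp
qed

lemma siblings_D_disjoint:
  assumes "c \<in> children v" "d \<in> children v" "c \<noteq> d"
  shows "D c \<inter> D d = {}"
proof (rule ccontr)
  assume "D c \<inter> D d \<noteq> {}"
  then obtain w where "w \<in> D c" "w \<in> D d" by blast
  then have w: "w = c \<or> anc c w" "w = d \<or> anc d w" by auto
  then have "anc c d \<or> anc d c" using anc_chain[of c w d] assms(3) by auto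
  then show False using siblings_incomparable assms by blast
qed

lemma D_children: "D v = insert v (\<Union>c\<in>children v. D c)"
proof
  show "D v \<subseteq> insert v (\<Union>c\<in>children v. D c)" using child_above_exists by fastforce
  show "insert v (\<Union>c\<in>children v. D c) \<subseteq> D v" by (auto intro: child_anc anc_trans[OF child_anc])
qed

lemma notin_D_child: "c \<in> children v \<Longrightarrow> v \<notin> D c"
  using child_anc anc_asym by auto

lemma leaf_no_desc: "v \<in> leaves \<Longrightarrow> \<not> anc v w"
  using child_above_exists by (auto simp: leaves_def)

text \<open>The subtree at \<open>v\<close> consists of \<open>v\<close> and the disjoint subtrees
  of its children. This recursion lets subtree sums be controlled from the root downwards.\<close>

lemma sum_D:
  fixes x :: "nat \<Rightarrow> 'a :: comm_monoid_add"
  shows "sum x (D v) = x v + (\<Sum>c\<in>children v. sum x (D c))"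
proof -
  have "sum x (D v) = x v + sum x (\<Union>c\<in>children v. D c)"
    using notin_D_child by (subst D_children) simp
  also have "sum x (\<Union>c\<in>children v. D c) = (\<Sum>c\<in>children v. sum x (D c))"
    by (rule sum.UNION_disjoint) (use siblings_D_disjoint in auto)
  finally show ?thesis .
qed

subsection \<open>Laplacian eigenvectors\<close>

lemma neighbours_eq: "{u \<in> verts n. E v u} = A v \<union> (D v - {v})"
  using anc_less by (auto simp: verts_def E_iff)

text \<open>The neighbours are the proper ancestors and the proper descendants; \<open>Suc\<close>
  accounts for \<open>v\<close> itself, which \<open>D v\<close> contains.\<close>

lemma degree_eq: "Suc (degree n E v) = card (A v) + card (D v)"
proof -
  have "card (A v \<union> (D v - {v})) = card (A v) + card (D v - {v})"
    by (rule card_Un_disjoint) (auto dest: anc_asym)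
  moreover have "Suc (card (D v - {v})) = card (D v)"
    by (rule card_Suc_Diff1) auto
  ultimately show ?thesis by (simp add: degree_def neighbours_eq)
qed

lemma laplacian_row_sum:
  assumes "j < n"
  shows "(\<Sum>i<n. f i * laplacian n E $$ (i, j)) =
    real (degree n E j) * f j - sum f (A j \<union> (D j - {j}))"
proof -
  have "(\<Sum>i<n. f i * laplacian n E $$ (i, j)) =
    (\<Sum>i<n. (if i = j then real (degree n E j) * f j else 0) - (if E j i then f i else 0))"
    using assms by (intro sum.cong) (auto simp: laplacian_def E_iff)
  also have "\<dots> = real (degree n E j) * f j - (\<Sum>i<n. if E j i then f i else 0)"
    using assms by (simp add: sum_subtractf)
  also have "(\<Sum>i<n. if E j i then f i else 0) = sum f {u \<in> verts n. E j u}"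
    by (subst sum.inter_filter[symmetric]) (auto simp: verts_def atLeast0LessThan)
  finally show ?thesis by (simp add: neighbours_eq)
qed

text \<open>The entry at \<open>j\<close> depends only on the edges at \<open>j\<close> that cross
  the boundary of \<open>D v\<close>. A vertex of \<open>D v\<close> sees exactly \<open>A v\<close>
  outside, a vertex of \<open>A v\<close> sees all of \<open>D v\<close>, and any other vertex sees
  none of it.\<close>

lemma laplacian_indicator_D:
  assumes "j < n"
  shows "(\<Sum>i<n. of_bool (i \<in> D v) * laplacian n E $$ (i, j)) =
    real (card (A v)) * of_bool (j \<in> D v) - real (card (D v)) * of_bool (j \<in> A v)"
proof -
  let ?N = "A j \<union> (D j - {j})"
  have deg: "degree n E j = card ?N" by (simp add: degree_def neighbours_eq)
  have eq: "(\<Sum>i<n. of_bool (i \<in> D v) * laplacian n E $$ (i, j)) =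
    real (card ?N) * of_bool (j \<in> D v) - real (card (?N \<inter> D v))"
    unfolding laplacian_row_sum[OF assms] deg by (simp add: sum_of_bool_eq del: in_D)
  consider "j \<in> D v" | "j \<in> A v" | "j \<notin> D v" "j \<notin> A v" by blast
  then show ?thesis
  proof cases
    case 1
    have "?N - D v = A v"
    proof
      show "?N - D v \<subseteq> A v"
      proof
        fix a assume "a \<in> ?N - D v"
        then show "a \<in> A v" using 1 anc_chain[of a j v] anc_trans[of v j a] by auto
      qed
      show "A v \<subseteq> ?N - D v"
      proof
        fix a assume "a \<in> A v"
        then show "a \<in> ?N - D v" using 1 anc_trans[of a v j] anc_asym[of a v] by auto
      qed
    qed
    moreover have "card ?N = card (?N \<inter> D v) + card (?N - D v)"
      by (rule card_Int_Diff) simp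
    moreover have "j \<notin> A v" using 1 anc_asym by auto
    ultimately show ?thesis using 1 unfolding eq by simp
  next
    case 2
    have "w \<in> ?N" if "w \<in> D v" for w
      using 2 that anc_trans[of j v w] by auto
    then have "?N \<inter> D v = D v" by blast
    moreover have "j \<notin> D v" using 2 anc_asym by auto
    ultimately show ?thesis using 2 unfolding eq by simp
  next
    case 3
    have "w \<notin> ?N" if "w \<in> D v" for w
      using 3 that anc_chain[of j w v] anc_trans[of v w j] by auto
    then have "?N \<inter> D v = {}" by blast
    then show ?thesis using 3 unfolding eq by simp
  qed
qed

lemma laplacian_indicator_singleton:
  assumes "j < n" "v < n"
  shows "(\<Sum>i<n. of_bool (i = v) * laplacian n E $$ (i, j)) =
    real (card (A v) + card (D v)) * of_bool (j = v) - of_bool (j \<in> D v) - of_bool (j \<in> A v)"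
proof -
  have "(\<Sum>i<n. of_bool (i = v) * laplacian n E $$ (i, j)) = laplacian n E $$ (v, j)"
    using assms by (subst sum.cong[OF refl, of _ _ "\<lambda>i. if i = v then laplacian n E $$ (v, j) else 0"]) auto
  also have "\<dots> = real (Suc (degree n E v)) * of_bool (j = v) - of_bool (j \<in> D v) - of_bool (j \<in> A v)"
    using assms anc_asym by (auto simp: laplacian_def E_iff)
  finally show ?thesis by (simp only: degree_eq)
qed

section \<open>The eigenbasis indexed by internal vertices and by non-first children\<close>

definition first_child :: "nat \<Rightarrow> nat" where "first_child v = (SOME c. c \<in> children v)"
definition parent :: "nat \<Rightarrow> nat" where "parent c = (SOME v. c \<in> children v)"

lemma first_child: "v \<in> internal \<Longrightarrow> first_child v \<in> children v"
  unfolding first_child_def internal_def by (auto intro: someI)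

lemma parent_eq: "c \<in> children v \<Longrightarrow> parent c = v"
  unfolding parent_def by (metis parent_unique someI)

lemma internalI: "c \<in> children v \<Longrightarrow> v \<in> internal"
  using child_less by (auto simp: internal_def)

text \<open>The root needs its own clause: it has no parent, so \<open>parent r\<close> is an
  unspecified value. Its vector is the all-ones vector, as \<open>D r\<close> contains every
  vertex.\<close>

fun eigvec :: "nat + nat \<Rightarrow> nat \<Rightarrow> real" where
  "eigvec (Inl v) j = real (card (D v)) * of_bool (j = v) - of_bool (j \<in> D v)"
| "eigvec (Inr c) j = (if c = r then of_bool (j \<in> D r) else
     real (card (D (first_child (parent c)))) * of_bool (j \<in> D c)
     - real (card (D c)) * of_bool (j \<in> D (first_child (parent c))))"

fun eigval :: "nat + nat \<Rightarrow> real" where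
  "eigval (Inl v) = real (card (A v) + card (D v))"
| "eigval (Inr c) = real (card (A c))"

text \<open>Every internal vertex has exactly one first child, so what is dropped on the right is
  regained on the left and the size is \<open>n\<close>. The root is nobody's child and stays on the
  right.\<close>

definition eig_index :: "(nat + nat) set" where
  "eig_index = internal <+> ({..<n} - first_child ` internal)"

lemma inj_first_child: "inj_on first_child internal"
  by (rule inj_onI) (metis first_child parent_unique)

lemma card_eig_index: "card eig_index = n" "finite eig_index"
proof -
  have sub: "first_child ` internal \<subseteq> {..<n}" using first_child child_less by blast
  have "card ({..<n} - first_child ` internal) = n - card internal"
    using sub by (subst card_Diff_subset) (auto simp: card_image[OF inj_first_child] finite_subset)
  moreover have "card internal \<le> n"
    using card_mono[OF _ sub] by (simp add: card_image[OF inj_first_child])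
  ultimately show "card eig_index = n" by (simp add: eig_index_def card_Plus)
  show "finite eig_index" by (simp add: eig_index_def)
qed

lemma not_anc_root [simp]: "\<not> anc v r"
  using anc_asym[of v r] root_anc[of v] anc_less[of v r] anc_irrefl by metis

lemma A_root: "A r = {}"
  by auto

text \<open>The coefficients make the indicator of the ancestors cancel: for \<open>Inl v\<close> it
  arises from both summands with opposite signs, and for \<open>Inr c\<close> the two siblings have
  the same ancestors. The root has no ancestors, whence the eigenvalue 0.\<close>

lemma laplacian_eigvec:
  assumes i: "i \<in> eig_index" and k: "k < n"
  shows "(\<Sum>j<n. eigvec i j * laplacian n E $$ (j, k)) = eigval i * eigvec i k"
proof (cases i)
  case (Inl v)
  then have v: "v < n" using i by (auto simp: eig_index_def internal_def)
  have "(\<Sum>j<n. eigvec i j * laplacian n E $$ (j, k)) =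
    real (card (D v)) * (\<Sum>j<n. of_bool (j = v) * laplacian n E $$ (j, k))
    - (\<Sum>j<n. of_bool (j \<in> D v) * laplacian n E $$ (j, k))"
    unfolding Inl eigvec.simps by (rule sum_scaled_diff[where b = 1, unfolded mult_1])
  also have "\<dots> = eigval i * eigvec i k"
    unfolding laplacian_indicator_D[OF k] laplacian_indicator_singleton[OF k v]
    by (simp add: Inl algebra_simps)
  finally show ?thesis .
next
  case (Inr c)
  then have c: "c < n" using i by (auto simp: eig_index_def)
  show ?thesis
  proof (cases "c = r")
    case True
    then show ?thesis using laplacian_indicator_D[OF k, of r] by (simp add: Inr A_root)
  next
    case False
    define s where "s = first_child (parent c)"
    obtain v where v: "c \<in> children v" using parent_exists c False by blast
    then have s: "s \<in> children v" using first_child internalI by (simp add: s_def parent_eq)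
    have A: "A s = A c" using v s by (simp add: children_def)
    have "(\<Sum>j<n. eigvec i j * laplacian n E $$ (j, k)) =
      real (card (D s)) * (\<Sum>j<n. of_bool (j \<in> D c) * laplacian n E $$ (j, k))
      - real (card (D c)) * (\<Sum>j<n. of_bool (j \<in> D s) * laplacian n E $$ (j, k))"
      unfolding Inr eigvec.simps if_not_P[OF False] s_def[symmetric] by (rule sum_scaled_diff)
    also have "\<dots> = eigval i * eigvec i k"
      using False unfolding laplacian_indicator_D[OF k] A
      by (simp add: Inr s_def[symmetric] algebra_simps)
    finally show ?thesis .
  qed
qed

text \<open>Let \<open>g v\<close> be the sum of \<open>x\<close> over the subtree at
  \<open>v\<close>. The root vector gives \<open>g r = 0\<close>, the sibling vectors make
  \<open>g\<close> proportional to subtree size among siblings, and the \<open>Inl\<close> vectors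
  give \<open>card (D v) * x v = g v\<close>. Descending from the root, \<open>g\<close> and hence
  \<open>x\<close> vanish.\<close>

lemma eigvec_total:
  assumes orth: "\<And>i. i \<in> eig_index \<Longrightarrow> (\<Sum>j<n. eigvec i j * x j) = 0" and "k < n"
  shows "x k = 0"
proof -
  define g where "g v = sum x (D v)" for v
  have sum_ind: "(\<Sum>j<n. of_bool (j \<in> D v) * x j) = g v" if "v < n" for v
  proof -
    have "{..<n} \<inter> D v = D v" using anc_less that by auto
    then have "g v = (\<Sum>j<n. if j \<in> D v then x j else 0)"
      unfolding g_def by (simp add: sum.inter_restrict[symmetric] del: in_D)
    also have "\<dots> = (\<Sum>j<n. of_bool (j \<in> D v) * x j)"
      by (intro sum.cong) (auto simp: of_bool_def)
    finally show ?thesis by simp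
  qed
  have point: "real (card (D v)) * x v = g v" if v: "v \<in> internal" for v
  proof -
    have "v < n" using v by (simp add: internal_def)
    have "(\<Sum>j<n. eigvec (Inl v) j * x j) =
      real (card (D v)) * (\<Sum>j<n. of_bool (j = v) * x j) - (\<Sum>j<n. of_bool (j \<in> D v) * x j)"
      unfolding eigvec.simps by (rule sum_scaled_diff[where b = 1, unfolded mult_1])
    also have "(\<Sum>j<n. of_bool (j = v) * x j) = x v"
      using \<open>v < n\<close> by (subst sum.cong[OF refl, of _ _ "\<lambda>j. if j = v then x v else 0"]) auto
    finally show ?thesis
      using orth[of "Inl v"] v sum_ind[OF \<open>v < n\<close>] by (auto simp: eig_index_def)
  qed
  have balance: "real (card (D (first_child v))) * g c = real (card (D c)) * g (first_child v)"
    if c: "c \<in> children v" for c v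
  proof (cases "c = first_child v")
    case False
    have s: "first_child v \<in> children v" using first_child internalI c by blast
    have "c \<noteq> r" using c child_anc A_root by fastforce
    \<comment> \<open>As \<open>c\<close> has only one parent, it is not the first child of another
      vertex either.\<close>
    have "c \<notin> first_child ` internal"
      using first_child parent_unique c False by blast
    then have "Inr c \<in> eig_index" using child_less c by (auto simp: eig_index_def)
    from orth[OF this] have "0 = (\<Sum>j<n. eigvec (Inr c) j * x j)" by simp
    also have "\<dots> = real (card (D (first_child v))) * (\<Sum>j<n. of_bool (j \<in> D c) * x j)
      - real (card (D c)) * (\<Sum>j<n. of_bool (j \<in> D (first_child v)) * x j)"
      unfolding eigvec.simps if_not_P[OF \<open>c \<noteq> r\<close>] parent_eq[OF c] by (rule sum_scaled_diff)
    finally show ?thesis using sum_ind child_less c s by simp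
  qed simp
  have "g v = 0" if "v < n" for v
    using that
  proof (induction "card (A v)" arbitrary: v rule: less_induct)
    case less
    show ?case
    proof (cases "v = r")
      case True
      have "r \<notin> first_child ` internal"
        using first_child child_anc A_root by (metis empty_iff imageE in_A)
      then have "Inr r \<in> eig_index" using root_less by (auto simp: eig_index_def)
      from orth[OF this] show ?thesis using sum_ind root_less True by simp
    next
      case False
      then obtain p where p: "v \<in> children p" using parent_exists less.prems by blast
      let ?s = "first_child p"
      have int: "p \<in> internal" using p internalI by blast
      have "g p = 0" using less.hyps[of p] card_A_less child_anc child_less p by blast
      then have "x p = 0" using point[OF int] card_D_pos[of p] by auto
      then have "(\<Sum>c\<in>children p. g c) = 0"
        using \<open>g p = 0\<close> sum_D[of x p] by (simp add: g_def)
      \<comment> \<open>By \<open>balance\<close> each summand is \<open>g ?s\<close> times a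
        positive subtree size, so the vanishing sum forces \<open>g ?s = 0\<close>.\<close>
      then have "0 = (\<Sum>c\<in>children p. real (card (D ?s)) * g c)"
        by (simp add: sum_distrib_left[symmetric])
      also have "\<dots> = (\<Sum>c\<in>children p. real (card (D c))) * g ?s"
        unfolding sum_distrib_right using balance by (intro sum.cong) auto
      finally have "(\<Sum>c\<in>children p. real (card (D c))) = 0 \<or> g ?s = 0" by auto
      moreover have "(\<Sum>c\<in>children p. real (card (D c))) > 0"
        using card_D_pos p by (intro sum_pos) auto
      ultimately have "g ?s = 0" by linarith
      then show ?thesis using balance[OF p] card_D_pos[of ?s] by auto
    qed
  qed
  then have g0: "g k = 0" using \<open>k < n\<close> by blast
  show ?thesis
  proof (cases "children k = {}")
    case True
    then show ?thesis using g0 sum_D[of x k] by (simp add: g_def)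
  next
    case False
    then show ?thesis
      using point[of k] g0 card_D_pos[of k] \<open>k < n\<close> by (auto simp: internal_def)
  qed
qed

lemma laplacian_spectrum_eq: "laplacian_spectrum n E = image_mset eigval (mset_set eig_index)"
  unfolding laplacian_spectrum_def
proof (rule proots_char_poly_eigenbasis[where f = eigvec])
  show "laplacian n E \<in> carrier_mat n n" by (simp add: laplacian_def)
  show "x k = 0" if "\<And>i. i \<in> eig_index \<Longrightarrow> (\<Sum>j<n. eigvec i j * x j) = 0" "k < n" for x k
    using that by (rule eigvec_total)
qed (use card_eig_index laplacian_eigvec in auto)

text \<open>Only the root has no ancestors, so dropping zeros discards the index
  \<open>Inr r\<close> alone. The remaining non-first children are grouped by parent, and each child
  of \<open>v\<close> contributes the size of \<open>A c = U v\<close>.\<close>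

lemma nonzero_laplacian_spectrum_eq:
  "nonzero_laplacian_spectrum n E =
    image_mset (\<lambda>v. real (degree n E v + 1)) (mset_set internal) +
    (\<Sum>v\<in>internal. replicate_mset (card (children v) - 1) (real (card (U v))))"
proof -
  let ?R = "{..<n} - first_child ` internal"
  have "eig_index = Inl ` internal \<union> Inr ` ?R" by (auto simp: eig_index_def)
  moreover have "mset_set (Inl ` internal \<union> Inr ` ?R) =
    image_mset Inl (mset_set internal) + image_mset Inr (mset_set ?R)"
    by (subst mset_set_Union) (auto simp: image_mset_mset_set)
  ultimately have spec: "laplacian_spectrum n E =
    image_mset (\<lambda>v. real (card (A v) + card (D v))) (mset_set internal) +
    image_mset (\<lambda>c. real (card (A c))) (mset_set ?R)"
    by (simp add: laplacian_spectrum_eq multiset.map_comp comp_def)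
  have deg: "real (card (A v) + card (D v)) = real (degree n E v + 1)" for v
    using degree_eq[of v] by simp
  have "filter_mset (\<lambda>x. x \<noteq> 0) (image_mset (\<lambda>v. real (degree n E v + 1)) (mset_set internal)) =
    image_mset (\<lambda>v. real (degree n E v + 1)) (mset_set internal)"
    by (subst filter_mset_eq_conv) auto
  moreover have "filter_mset (\<lambda>x. x \<noteq> 0) (image_mset (\<lambda>c. real (card (A c))) (mset_set ?R)) =
    (\<Sum>v\<in>internal. replicate_mset (card (children v) - 1) (real (card (U v))))"
  proof -
    have "A c = {} \<longleftrightarrow> c = r" if "c < n" for c
      using that A_root root_anc[of c] by (metis empty_iff in_A)
    then have "{c \<in> ?R. real (card (A c)) \<noteq> 0} = ?R - {r}" by auto
    also have "\<dots> = (\<Union>v\<in>internal. children v - {first_child v})"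
    proof
      show "?R - {r} \<subseteq> (\<Union>v\<in>internal. children v - {first_child v})"
        using parent_exists internalI by fastforce
      show "(\<Union>v\<in>internal. children v - {first_child v}) \<subseteq> ?R - {r}"
      proof
        fix c assume "c \<in> (\<Union>v\<in>internal. children v - {first_child v})"
        then obtain v where v: "c \<in> children v" "c \<noteq> first_child v" by blast
        have "c \<notin> first_child ` internal" using v first_child parent_unique by blast
        moreover have "c \<noteq> r" using child_anc[OF v(1)] by auto
        ultimately show "c \<in> ?R - {r}" using child_less v by auto
      qed
    qed
    finally have "filter_mset (\<lambda>x. x \<noteq> 0) (image_mset (\<lambda>c. real (card (A c))) (mset_set ?R)) =
      image_mset (\<lambda>c. real (card (A c))) (mset_set (\<Union>v\<in>internal. children v - {first_child v}))"
      by (simp add: filter_mset_image_mset comp_def)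
    also have "\<dots> = (\<Sum>c\<in>(\<Union>v\<in>internal. children v - {first_child v}). {#real (card (A c))#})"
      by (rule image_mset_mset_set_sum) simp
    also have "\<dots> = (\<Sum>v\<in>internal. \<Sum>c\<in>children v - {first_child v}. {#real (card (A c))#})"
      by (rule sum.UNION_disjoint) (use parent_unique in auto)
    also have "\<dots> = (\<Sum>v\<in>internal. replicate_mset (card (children v) - 1) (real (card (U v))))"
    proof (rule sum.cong[OF refl])
      fix v assume "v \<in> internal"
      then have "card (children v) - 1 = card (children v - {first_child v})"
        using first_child by simp
      moreover have "real (card (A c)) = real (card (U v))" if "c \<in> children v - {first_child v}" for c
        using that by (simp add: children_def)
      ultimately show "(\<Sum>c\<in>children v - {first_child v}. {#real (card (A c))#}) =
        replicate_mset (card (children v) - 1) (real (card (U v)))"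
        using sum_singleton_mset_const[of "children v - {first_child v}" "\<lambda>c. real (card (A c))"] by simp
    qed
    finally show ?thesis .
  qed
  ultimately show ?thesis
    by (simp only: nonzero_laplacian_spectrum_def spec deg filter_union_mset)
qed

subsection \<open>Cliques and simplicial vertices\<close>

lemma clique_iff:
  "is_clique n E K \<longleftrightarrow> K \<subseteq> {..<n} \<and> (\<forall>x\<in>K. \<forall>y\<in>K. x = y \<or> anc x y \<or> anc y x)"
  unfolding is_clique_def E_iff by (auto simp: verts_def)

lemma U_mono: "anc u v \<Longrightarrow> U u \<subseteq> U v"
  using anc_trans[of _ u v] by auto

lemma clique_U: "v < n \<Longrightarrow> is_clique n E (U v)"
proof -
  assume "v < n"
  have "x = y \<or> anc x y \<or> anc y x" if "x \<in> U v" "y \<in> U v" for x y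
    using that anc_chain[of x v y] by auto
  moreover have "U v \<subseteq> {..<n}" using \<open>v < n\<close> anc_less[of _ v] by auto
  ultimately show ?thesis by (simp add: clique_iff)
qed

lemma leaf_below:
  assumes "v < n" shows "\<exists>l\<in>leaves. v \<in> U l"
proof -
  obtain l where l: "l \<in> D v" and deepest: "\<And>w. w \<in> D v \<Longrightarrow> card (A w) \<le> card (A l)"
  proof (rule finite_max_exists[of "D v" "\<lambda>w. card (A w)"])
    show "D v \<noteq> {}" by (simp add: D_def)
  qed auto
  have "children l = {}"
  proof (rule ccontr)
    assume "children l \<noteq> {}"
    then obtain c where "anc l c" using child_anc by blast
    moreover from this have "c \<in> D v" using l anc_trans[of v l c] by auto
    ultimately show False using deepest[of c] card_A_less[of l c] by simp
  qed
  moreover have "l < n" using l assms anc_less[of v l] by auto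
  ultimately show ?thesis using l by (auto simp: leaves_def)
qed

text \<open>A clique is a chain, so it lies in \<open>U v\<close> for its deepest member
  \<open>v\<close>, and \<open>U\<close> only grows on the way down to a leaf.\<close>

lemma clique_subset_leaf:
  assumes K: "is_clique n E K" shows "\<exists>l\<in>leaves. K \<subseteq> U l"
proof (cases "K = {}")
  case True
  then show ?thesis using leaf_below[OF root_less] by blast
next
  case False
  have "finite K" using K finite_subset by (auto simp: clique_iff)
  then obtain v where v: "v \<in> K" and deepest: "\<And>w. w \<in> K \<Longrightarrow> card (A w) \<le> card (A v)"
    using finite_max_exists[OF _ False, of "\<lambda>w. card (A w)"] by blast
  have "w = v \<or> anc w v" if "w \<in> K" for w
  proof (rule ccontr)
    assume "\<not> ?thesis"
    then have "anc v w" using K v that by (auto simp: clique_iff)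
    then show False using card_A_less deepest that by (meson leD)
  qed
  then have "K \<subseteq> U v" by auto
  moreover obtain l where l: "l \<in> leaves" "v \<in> U l"
    using leaf_below[of v] v K by (auto simp: clique_iff)
  ultimately show ?thesis using U_mono[of v l] by auto
qed

lemma leaf_U_subset: "l \<in> leaves \<Longrightarrow> U l \<subseteq> U m \<Longrightarrow> l = m"
  using leaf_no_desc[of l m] by auto

lemma maximal_cliques_eq: "maximal_cliques n E = U ` leaves"
proof
  show "maximal_cliques n E \<subseteq> U ` leaves"
  proof
    fix K assume K: "K \<in> maximal_cliques n E"
    then obtain l where l: "l \<in> leaves" "K \<subseteq> U l"
      using clique_subset_leaf[of K] unfolding maximal_cliques_def by blast
    moreover have "is_clique n E (U l)" using l clique_U by (auto simp: leaves_def)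
    ultimately show "K \<in> U ` leaves" using K by (auto simp: maximal_cliques_def)
  qed
  show "U ` leaves \<subseteq> maximal_cliques n E"
  proof
    fix K assume "K \<in> U ` leaves"
    then obtain l where l: "l \<in> leaves" "K = U l" by blast
    have "K' = U l" if K': "is_clique n E K'" "U l \<subseteq> K'" for K'
    proof -
      obtain m where "m \<in> leaves" "K' \<subseteq> U m" using clique_subset_leaf K' by blast
      moreover from this have "l = m" using leaf_U_subset l K' by blast
      ultimately show ?thesis using K' by blast
    qed
    then show "K \<in> maximal_cliques n E"
      using l clique_U by (auto simp: maximal_cliques_def leaves_def)
  qed
qed

lemma inj_on_U: "inj_on U S"
  using inj_U by (auto intro: inj_onI)

lemma finite_maximal_cliques [simp]: "finite (maximal_cliques n E)"
  by (simp add: maximal_cliques_eq)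

lemma simplicial_iff: "simplicial n E v \<longleftrightarrow> v < n \<and> is_clique n E (A v \<union> (D v - {v}))"
  unfolding simplicial_def neighbours_eq by (simp add: verts_def)

lemma leaf_simplicial:
  assumes "l \<in> leaves" shows "simplicial n E l"
proof -
  have "A l \<union> (D l - {l}) = A l" using leaf_no_desc[OF assms] by auto
  moreover have "l < n" using assms by (simp add: leaves_def)
  moreover have "is_clique n E (A l)"
    using clique_U[OF \<open>l < n\<close>] by (auto simp: clique_iff)
  ultimately show ?thesis by (simp add: simplicial_iff)
qed

text \<open>If \<open>v\<close> is not \<open>l\<close> itself, then \<open>l\<close> is a neighbour
  of \<open>v\<close>, so every other neighbour is comparable with the leaf \<open>l\<close> and
  hence above it. Thus \<open>v\<close> determines its maximal clique and has degree one less than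
  the size of that clique.\<close>

lemma simplicial_closed_neighbourhood:
  assumes v: "simplicial n E v" "v \<in> U l" and l: "l \<in> leaves"
  shows "A v \<union> D v = U l"
proof
  have clique: "x = y \<or> anc x y \<or> anc y x"
    if "x \<in> A v \<union> (D v - {v})" "y \<in> A v \<union> (D v - {v})" for x y
    using v that unfolding simplicial_iff clique_iff by blast
  show "A v \<union> D v \<subseteq> U l"
  proof
    fix w assume w: "w \<in> A v \<union> D v"
    show "w \<in> U l"
    proof (cases "v = l")
      case True
      then show ?thesis using w leaf_no_desc[OF l] by auto
    next
      case False
      then have "anc v l" using v by auto
      moreover from this have "w = v \<or> w = l \<or> anc w l \<or> anc l w"
        using clique[of w l] w by auto
      ultimately show ?thesis using leaf_no_desc[OF l] by auto
    qed
  qed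
  show "U l \<subseteq> A v \<union> D v"
  proof
    fix w assume "w \<in> U l"
    then show "w \<in> A v \<union> D v" using v(2) anc_chain[of v l w] by auto
  qed
qed

lemma simplicial_degree:
  assumes "simplicial n E v" "v \<in> U l" "l \<in> leaves"
  shows "degree n E v + 1 = card (U l)"
proof -
  have "card (A v \<union> D v) = card (A v) + card (D v)"
    by (rule card_Un_disjoint) (auto dest: anc_asym)
  then show ?thesis
    using degree_eq[of v] simplicial_closed_neighbourhood[OF assms] by simp
qed

text \<open>The internal vertices are the non-simplicial vertices and the simplicial non-leaves.
  Each maximal clique \<open>U l\<close> contains the single leaf \<open>l\<close>, which is
  simplicial; removing it accounts for the \<open>- 1\<close>.\<close>

lemma degree_multiset_internal:
  "image_mset (\<lambda>v. real (degree n E v + 1)) (mset_set internal) =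
    image_mset (\<lambda>v. real (degree n E v + 1)) (mset_set {v \<in> verts n. \<not> simplicial n E v})
    + (\<Sum>Q\<in>maximal_cliques n E. replicate_mset (card (Simp n E Q) - 1) (real (card Q)))"
proof -
  let ?d = "\<lambda>v. real (degree n E v + 1)"
  let ?NS = "{v \<in> verts n. \<not> simplicial n E v}"
  let ?S = "\<Union>l\<in>leaves. Simp n E (U l) - {l}"
  have lU: "l \<in> Simp n E (U l)" if "l \<in> leaves" for l
    using leaf_simplicial that by (simp add: Simp_def)
  have finS: "finite (Simp n E (U l))" for l
    by (rule finite_subset[of _ "U l"]) (auto simp: Simp_def)
  have split: "internal = ?NS \<union> ?S"
  proof
    show "internal \<subseteq> ?NS \<union> ?S"
    proof
      fix v assume v: "v \<in> internal"
      then obtain l where l: "l \<in> leaves" "v \<in> U l" using leaf_below by (auto simp: internal_def)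
      moreover have "v \<noteq> l" using v l by (auto simp: internal_def leaves_def)
      ultimately show "v \<in> ?NS \<union> ?S" using v by (auto simp: Simp_def internal_def verts_def)
    qed
    show "?NS \<union> ?S \<subseteq> internal"
    proof
      fix v assume "v \<in> ?NS \<union> ?S"
      then have "v < n" "v \<notin> leaves"
        using leaf_simplicial leaf_no_desc by (auto simp: verts_def Simp_def simplicial_def)
      then show "v \<in> internal" by (simp add: internal_def leaves_def)
    qed
  qed
  have "mset_set internal = mset_set ?NS + mset_set ?S"
  proof -
    have "?S \<subseteq> {v. simplicial n E v}" by (auto simp: Simp_def)
    then show ?thesis unfolding split
      by (intro mset_set_Union) (use finS in \<open>auto simp: verts_def\<close>)
  qed
  moreover have "image_mset ?d (mset_set ?S) =
    (\<Sum>Q\<in>maximal_cliques n E. replicate_mset (card (Simp n E Q) - 1) (real (card Q)))"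
  proof -
    have "image_mset ?d (mset_set ?S) = (\<Sum>v\<in>?S. {#?d v#})"
      by (rule image_mset_mset_set_sum) (simp add: finS)
    also have "\<dots> = (\<Sum>l\<in>leaves. \<Sum>v\<in>Simp n E (U l) - {l}. {#?d v#})"
    proof (rule sum.UNION_disjoint)
      show "\<forall>l\<in>leaves. \<forall>m\<in>leaves. l \<noteq> m \<longrightarrow> (Simp n E (U l) - {l}) \<inter> (Simp n E (U m) - {m}) = {}"
      proof (intro ballI impI)
        fix l m assume lm: "l \<in> leaves" "m \<in> leaves" "l \<noteq> m"
        have "U l = U m" if "v \<in> Simp n E (U l)" "v \<in> Simp n E (U m)" for v
          using that lm simplicial_closed_neighbourhood[of v l] simplicial_closed_neighbourhood[of v m]
          unfolding Simp_def by blast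
        then show "(Simp n E (U l) - {l}) \<inter> (Simp n E (U m) - {m}) = {}"
          using inj_U lm by blast
      qed
    qed (auto simp: finS)
    also have "\<dots> = (\<Sum>l\<in>leaves. replicate_mset (card (Simp n E (U l)) - 1) (real (card (U l))))"
    proof (rule sum.cong[OF refl])
      fix l assume l: "l \<in> leaves"
      have "?d v = real (card (U l))" if "v \<in> Simp n E (U l) - {l}" for v
        using simplicial_degree[of v l] that l by (simp add: Simp_def del: in_U)
      then have "(\<Sum>v\<in>Simp n E (U l) - {l}. {#?d v#}) =
        replicate_mset (card (Simp n E (U l) - {l})) (real (card (U l)))"
        using finS by (intro sum_singleton_mset_const) auto
      then show "(\<Sum>v\<in>Simp n E (U l) - {l}. {#?d v#}) =
        replicate_mset (card (Simp n E (U l)) - 1) (real (card (U l)))"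
        using lU[OF l] by simp
    qed
    also have "\<dots> = (\<Sum>Q\<in>maximal_cliques n E. replicate_mset (card (Simp n E Q) - 1) (real (card Q)))"
      unfolding maximal_cliques_eq by (simp add: sum.reindex[OF inj_on_U])
    finally show ?thesis .
  qed
  ultimately show ?thesis by simp
qed

subsection \<open>Clique trees\<close>

lemma maximal_clique_anc:
  "Q \<in> maximal_cliques n E \<Longrightarrow> w \<in> Q \<Longrightarrow> anc u w \<Longrightarrow> u \<in> Q"
  using anc_trans[of u w] by (auto simp: maximal_cliques_eq)

lemma maximal_clique_comparable:
  assumes "Q \<in> maximal_cliques n E" "v \<in> Q" "w \<in> Q"
  shows "v = w \<or> anc v w \<or> anc w v"
proof -
  obtain l where "Q = U l" using assms(1) by (auto simp: maximal_cliques_eq)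
  then show ?thesis using assms(2,3) anc_chain[of v l w] by auto
qed

text \<open>Ensures that the choice in \<open>sep_mult\<close> picks a genuine clique tree. The
  intersections of \<open>Q\<close> with other maximal cliques are ancestor-closed parts of the
  chain \<open>Q\<close>, hence nested, as the junction tree construction requires.\<close>

lemma clique_tree_exists: "\<exists>T. is_clique_tree n E T"
proof -
  have "maximal_cliques n E \<noteq> {}"
    using leaf_below[OF root_less] by (auto simp: maximal_cliques_eq)
  moreover have "Q \<inter> Q1 \<subseteq> Q \<inter> Q2 \<or> Q \<inter> Q2 \<subseteq> Q \<inter> Q1"
    if "Q \<in> maximal_cliques n E" "Q1 \<in> maximal_cliques n E" "Q2 \<in> maximal_cliques n E" for Q Q1 Q2
    using maximal_clique_comparable[OF that(1)] maximal_clique_anc[OF that(2)]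
      maximal_clique_anc[OF that(3)] by blast
  moreover have "finite Q" if "Q \<in> maximal_cliques n E" for Q
    using that by (auto simp: maximal_cliques_eq)
  ultimately obtain T where "is_tree (maximal_cliques n E) T"
    "\<And>p R. is_path_in T p \<Longrightarrow> hd p \<in> maximal_cliques n E \<Longrightarrow> last p \<in> maximal_cliques n E \<Longrightarrow>
      R \<in> set p \<Longrightarrow> hd p \<inter> last p \<subseteq> R"
    using junction_tree_exists[of "maximal_cliques n E"] finite_maximal_cliques by metis
  then have "is_clique_tree n E T" unfolding is_clique_tree_def by blast
  then show ?thesis ..
qed

section \<open>Subtrees of cliques through a vertex and separator multiplicities\<close>

definition cliques_at :: "nat \<Rightarrow> nat set set" where
  "cliques_at v = {Q \<in> maximal_cliques n E. v \<in> Q}"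

lemma finite_cliques_at [simp]: "finite (cliques_at v)"
  by (simp add: cliques_at_def)

lemma cliques_at_nonempty: "v < n \<Longrightarrow> cliques_at v \<noteq> {}"
  using leaf_below by (auto simp: cliques_at_def maximal_cliques_eq)

lemma cliques_at_siblings_disjoint:
  assumes "c \<in> children v" "d \<in> children v" "c \<noteq> d"
  shows "cliques_at c \<inter> cliques_at d = {}"
  using assms siblings_incomparable maximal_clique_comparable unfolding cliques_at_def by blast

lemma cliques_at_child_subset: "c \<in> children v \<Longrightarrow> cliques_at c \<subseteq> cliques_at v"
  using child_anc maximal_clique_anc unfolding cliques_at_def by blast

lemma cliques_at_internal:
  assumes "v \<in> internal" shows "cliques_at v = (\<Union>c\<in>children v. cliques_at c)"
proof
  show "cliques_at v \<subseteq> (\<Union>c\<in>children v. cliques_at c)"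
  proof
    fix Q assume Q: "Q \<in> cliques_at v"
    then obtain l where l: "l \<in> leaves" "Q = U l" "v \<in> U l"
      by (auto simp: cliques_at_def maximal_cliques_eq)
    have "v \<noteq> l" using assms l by (auto simp: internal_def leaves_def)
    then have "anc v l" using l by simp
    then obtain c where "c \<in> children v" "l \<in> D c" using child_above_exists by blast
    then show "Q \<in> (\<Union>c\<in>children v. cliques_at c)"
      using Q l by (auto simp: cliques_at_def)
  qed
qed (use cliques_at_child_subset in blast)

lemma card_cliques_at_internal:
  assumes "v \<in> internal"
  shows "card (cliques_at v) = (\<Sum>c\<in>children v. card (cliques_at c))"
  unfolding cliques_at_internal[OF assms]
  by (rule card_UN_disjoint) (use cliques_at_siblings_disjoint in auto)

text \<open>The clique tree property says precisely that a path between two cliques containing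
  \<open>v\<close> stays among such cliques, so these span a subtree.\<close>

lemma card_clique_tree_edges_at:
  assumes T: "is_clique_tree n E T" and v: "v < n"
  shows "Suc (card {e \<in> T. e \<subseteq> cliques_at v}) = card (cliques_at v)"
proof (rule is_tree_card_edges, rule is_tree_restrict)
  show tree: "is_tree (maximal_cliques n E) T" using T by (simp add: is_clique_tree_def)
  show "cliques_at v \<subseteq> maximal_cliques n E" by (auto simp: cliques_at_def)
  show "cliques_at v \<noteq> {}" using v by (rule cliques_at_nonempty)
  show "set p \<subseteq> cliques_at v"
    if p: "is_path_in T p" "hd p \<in> cliques_at v" "last p \<in> cliques_at v" for p
  proof
    fix R assume R: "R \<in> set p"
    have "set p \<subseteq> maximal_cliques n E"
      using is_path_in_subset_hd[OF is_tree_edge_subset[OF tree] p(1)] p(2) by (simp add: cliques_at_def)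
    moreover have "hd p \<inter> last p \<subseteq> R"
      using T p R unfolding is_clique_tree_def cliques_at_def by blast
    ultimately show "R \<in> cliques_at v" using p R by (auto simp: cliques_at_def)
  qed
qed

text \<open>The intersection is an ancestor-closed chain, and \<open>no_child\<close> makes
  \<open>v\<close> its deepest element.\<close>

lemma Int_maximal_cliques_eq_U:
  assumes Q: "Q \<in> maximal_cliques n E" "Q' \<in> maximal_cliques n E" and v: "v \<in> Q \<inter> Q'"
    and no_child: "\<And>c. c \<in> children v \<Longrightarrow> c \<notin> Q \<inter> Q'"
  shows "Q \<inter> Q' = U v"
proof
  show "U v \<subseteq> Q \<inter> Q'" using v maximal_clique_anc[OF Q(1)] maximal_clique_anc[OF Q(2)] by auto
  show "Q \<inter> Q' \<subseteq> U v"
  proof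
    fix w assume w: "w \<in> Q \<inter> Q'"
    have "\<not> anc v w"
    proof
      assume "anc v w"
      then obtain c where c: "c \<in> children v" "w \<in> D c" using child_above_exists by blast
      then have "c \<in> Q \<inter> Q'"
        using w maximal_clique_anc[OF Q(1), of w c] maximal_clique_anc[OF Q(2), of w c] by auto
      then show False using no_child c by blast
    qed
    then show "w \<in> U v" using maximal_clique_comparable[OF Q(1), of v w] v w by auto
  qed
qed

text \<open>An edge between two cliques containing \<open>v\<close> either joins two cliques
  containing a common child of \<open>v\<close>, or its intersection is \<open>U v\<close>. With
  \<open>k\<close> children, the edge counts of the subtrees leave \<open>k - 1\<close> edges of the
  second sort, whichever clique tree is taken.\<close>

lemma card_clique_tree_edges_eq:
  assumes T: "is_clique_tree n E T" and v: "v \<in> internal"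
  shows "card {e \<in> T. \<exists>Q Q'. e = {Q, Q'} \<and> Q \<inter> Q' = U v} = card (children v) - 1"
proof -
  define M where "M = {e \<in> T. \<exists>Q Q'. e = {Q, Q'} \<and> Q \<inter> Q' = U v}"
  define B where "B w = {e \<in> T. e \<subseteq> cliques_at w}" for w
  have tree: "is_tree (maximal_cliques n E) T" using T by (simp add: is_clique_tree_def)
  have fin: "finite T" by (rule is_tree_finite_edges[OF tree])
  have not_child: "c \<notin> U v" if "c \<in> children v" for c
    using child_anc[OF that] anc_asym by auto
  have split: "B v = M \<union> (\<Union>c\<in>children v. B c)"
  proof
    show "B v \<subseteq> M \<union> (\<Union>c\<in>children v. B c)"
    proof
      fix e assume e: "e \<in> B v"
      then have "e \<in> T" by (simp add: B_def)
      then obtain Q Q' where Q: "Q \<in> maximal_cliques n E" "Q' \<in> maximal_cliques n E" "Q \<noteq> Q'"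
        "e = {Q, Q'}" by (rule is_tree_edgeE[OF tree])
      have "v \<in> Q \<inter> Q'" using e Q by (auto simp: cliques_at_def B_def)
      then have "Q \<inter> Q' = U v \<or> (\<exists>c\<in>children v. c \<in> Q \<inter> Q')"
        using Int_maximal_cliques_eq_U[OF Q(1,2)] by blast
      then show "e \<in> M \<union> (\<Union>c\<in>children v. B c)"
        using \<open>e \<in> T\<close> Q by (auto simp: cliques_at_def B_def M_def)
    qed
    have "M \<subseteq> B v"
    proof
      fix e assume e: "e \<in> M"
      then obtain Q Q' where Q: "e = {Q, Q'}" "Q \<inter> Q' = U v" unfolding M_def by blast
      then have "v \<in> Q \<inter> Q'" by simp
      moreover have "e \<subseteq> maximal_cliques n E" using e is_tree_edge_subset[OF tree] unfolding M_def by blast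
      ultimately show "e \<in> B v" using e Q by (auto simp: cliques_at_def B_def M_def)
    qed
    moreover have "B c \<subseteq> B v" if "c \<in> children v" for c
      using cliques_at_child_subset[OF that] unfolding B_def by blast
    ultimately show "M \<union> (\<Union>c\<in>children v. B c) \<subseteq> B v" by blast
  qed
  have "M \<inter> B c = {}" if c: "c \<in> children v" for c
  proof -
    have "c \<in> Q \<inter> Q'" if "{Q, Q'} \<subseteq> cliques_at c" for Q Q'
      using that by (simp add: cliques_at_def)
    then show ?thesis using not_child[OF c] unfolding M_def B_def by blast
  qed
  then have "M \<inter> (\<Union>c\<in>children v. B c) = {}" by blast
  then have "card (B v) = card M + card (\<Union>c\<in>children v. B c)"
    unfolding split using fin by (intro card_Un_disjoint) (auto simp: B_def M_def)
  moreover have "card (\<Union>c\<in>children v. B c) = (\<Sum>c\<in>children v. card (B c))"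
  proof (rule card_UN_disjoint)
    show "\<forall>c\<in>children v. \<forall>d\<in>children v. c \<noteq> d \<longrightarrow> B c \<inter> B d = {}"
    proof (intro ballI impI)
      fix c d assume cd: "c \<in> children v" "d \<in> children v" "c \<noteq> d"
      \<comment> \<open>The empty set would belong to both \<open>B c\<close> and
        \<open>B d\<close>, so disjointness uses that edges are nonempty.\<close>
      have "e \<noteq> {}" if "e \<in> T" for e using is_tree_edgeE[OF tree that] by blast
      then show "B c \<inter> B d = {}" using cliques_at_siblings_disjoint[OF cd] unfolding B_def by blast
    qed
  qed (use fin in \<open>auto simp: B_def\<close>)
  moreover have "card (cliques_at v) = (\<Sum>c\<in>children v. card (B c)) + card (children v)"
  proof -
    have "card (cliques_at v) = (\<Sum>c\<in>children v. card (B c) + 1)"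
      unfolding card_cliques_at_internal[OF v]
      using card_clique_tree_edges_at[OF T] child_less by (intro sum.cong) (auto simp: B_def)
    also have "\<dots> = (\<Sum>c\<in>children v. card (B c)) + (\<Sum>c\<in>children v. 1)"
      by (rule sum.distrib)
    finally show ?thesis by simp
  qed
  moreover have "Suc (card (B v)) = card (cliques_at v)"
    using card_clique_tree_edges_at[OF T] v by (simp add: internal_def B_def)
  ultimately have "card M = card (children v) - 1" by linarith
  then show ?thesis by (simp only: M_def)
qed

lemma sep_mult_eq: "v \<in> internal \<Longrightarrow> sep_mult n E (U v) = card (children v) - 1"
  unfolding sep_mult_def Let_def
  by (rule card_clique_tree_edges_eq[OF someI_ex[OF clique_tree_exists]])

subsection \<open>Minimal vertex separators\<close>

text \<open>A common ancestor outside \<open>S\<close> would be adjacent to both \<open>u\<close>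
  and \<open>v\<close> and so connect them.\<close>

lemma common_anc_subset_separator:
  assumes "separates n E S u v" shows "A u \<inter> A v \<subseteq> S"
proof (rule ccontr)
  assume "\<not> A u \<inter> A v \<subseteq> S"
  then obtain w where "w \<in> A u" "w \<in> A v" "w \<notin> S" by blast
  then have w: "anc w u" "anc w v" "w \<notin> S" by simp_all
  define R where "R = (\<lambda>x y. E x y \<and> x \<in> verts n - S \<and> y \<in> verts n - S)"
  have uv: "u \<in> verts n - S" "v \<in> verts n - S" using assms by (auto simp: separates_def)
  have "w \<in> verts n - S" using w anc_less[of w u] by (auto simp: verts_def)
  then have "R u w" "R w v" using uv w by (auto simp: R_def E_iff)
  then have "R\<^sup>*\<^sup>* u v" by (meson converse_rtranclp_into_rtranclp r_into_rtranclp)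
  then show False using assms uv by (auto simp: separates_def reachable_in_def R_def)
qed

text \<open>An edge leaving \<open>D c\<close> can only end in a proper ancestor of
  \<open>c\<close>, that is, in the deleted set \<open>U w\<close>; a walk from \<open>u\<close>
  therefore stays in \<open>D c\<close>.\<close>

lemma branching_separates:
  assumes c: "c \<in> children w" "d \<in> children w" "c \<noteq> d" and u: "u \<in> D c" and v: "v \<in> D d"
  shows "separates n E (U w) u v"
proof -
  define R where "R = (\<lambda>x y. E x y \<and> x \<in> verts n - U w \<and> y \<in> verts n - U w)"
  have A: "A c = U w" "A d = U w" using c by (auto simp: children_def)
  have notU: "x \<notin> U w" if "x \<in> D a" "A a = U w" for x a
  proof
    assume "x \<in> U w"
    then have "anc x a" using that by (metis in_A)
    then show False using that(1) anc_asym by auto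
  qed
  have dom: "u < n" "v < n" "U w \<subseteq> verts n"
    using u v c child_less anc_less child_less[OF c(1)] by (auto simp: verts_def)
  have step: "y \<in> D c" if "x \<in> D c" "R x y" for x y
  proof -
    have "\<not> anc y c" using that(2) A(1) by (metis Diff_iff R_def in_A)
    moreover have "anc x y \<or> anc y x" using that by (simp add: R_def E_iff)
    ultimately show ?thesis
      using that(1) anc_trans[of c x y] anc_chain[of c x y] by auto
  qed
  have "y \<in> D c" if "R\<^sup>*\<^sup>* u y" for y
    using that u by (induction rule: rtranclp_induct) (use step in blast)+
  then have "\<not> R\<^sup>*\<^sup>* u v" using siblings_D_disjoint[OF c] v by blast
  then show ?thesis
    using dom notU[OF u A(1)] notU[OF v A(2)]
    by (auto simp: separates_def reachable_in_def R_def verts_def)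
qed

text \<open>Take \<open>w\<close> as the deepest common ancestor, which exists because the root is
  one. If the children towards \<open>u\<close> and \<open>v\<close> agreed, that child would be a
  deeper common ancestor.\<close>

lemma incomparable_branching:
  assumes "u < n" "v < n" "u \<noteq> v" "\<not> E u v"
  obtains w c d where "A u \<inter> A v = U w" "c \<in> children w" "d \<in> children w" "c \<noteq> d"
    "u \<in> D c" "v \<in> D d"
proof -
  let ?C = "A u \<inter> A v"
  have inc: "\<not> anc u v" "\<not> anc v u" using assms by (auto simp: E_iff)
  have "r \<in> ?C" using root_anc[of u] root_anc[of v] assms inc by auto
  then have ne: "?C \<noteq> {}" by blast
  have "finite ?C" by simp
  from finite_max_exists[OF this ne, of "\<lambda>a. card (A a)"]
  obtain w where w: "w \<in> ?C" and deepest: "\<And>a. a \<in> ?C \<Longrightarrow> card (A a) \<le> card (A w)" by blast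
  have C: "?C = U w"
  proof
    show "?C \<subseteq> U w"
    proof
      fix a assume a: "a \<in> ?C"
      have "\<not> anc w a" using deepest[OF a] card_A_less[of w a] by auto
      then show "a \<in> U w" using a w anc_chain[of a u w] by auto
    qed
    show "U w \<subseteq> ?C" using w anc_trans[of _ w u] anc_trans[of _ w v] by auto
  qed
  obtain c where c: "c \<in> children w" "u \<in> D c" using child_above_exists[of w u] w by auto
  obtain d where d: "d \<in> children w" "v \<in> D d" using child_above_exists[of w v] w by auto
  have "c \<noteq> d"
  proof
    assume "c = d"
    then have "c \<in> ?C" using c d inc assms(3) by auto
    then have "c \<in> A c" using C c by (simp add: children_def)
    then show False by simp
  qed
  then show thesis using that C c d by blast
qed

text \<open>For non-adjacent \<open>u\<close> and \<open>v\<close> branching at \<open>w\<close>,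
  every separator contains \<open>U w\<close> and \<open>U w\<close> itself separates. Conversely,
  two children of \<open>w\<close> are a pair for which \<open>U w\<close> is minimal.\<close>

lemma minimal_vertex_separators_eq:
  "minimal_vertex_separators n E = U ` {w \<in> internal. card (children w) \<ge> 2}"
proof
  show "minimal_vertex_separators n E \<subseteq> U ` {w \<in> internal. card (children w) \<ge> 2}"
  proof
    fix S assume "S \<in> minimal_vertex_separators n E"
    then obtain u v where uv: "u \<noteq> v" "\<not> E u v" "separates n E S u v"
      and min: "\<And>T. T \<subset> S \<Longrightarrow> \<not> separates n E T u v"
      by (auto simp: minimal_vertex_separators_def)
    have "u < n" "v < n" using uv by (auto simp: separates_def verts_def)
    then obtain w c d where w: "A u \<inter> A v = U w" "c \<in> children w" "d \<in> children w" "c \<noteq> d"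
      "u \<in> D c" "v \<in> D d" using incomparable_branching uv by metis
    have "U w \<subseteq> S" using common_anc_subset_separator[OF uv(3)] w by simp
    moreover have "separates n E (U w) u v" using branching_separates w by blast
    ultimately have "S = U w" using min by blast
    moreover have "card (children w) \<ge> 2"
      using card_mono[of "children w" "{c, d}"] w by simp
    ultimately show "S \<in> U ` {w \<in> internal. card (children w) \<ge> 2}"
      using internalI w by blast
  qed
  show "U ` {w \<in> internal. card (children w) \<ge> 2} \<subseteq> minimal_vertex_separators n E"
  proof
    fix S assume "S \<in> U ` {w \<in> internal. card (children w) \<ge> 2}"
    then obtain w where w: "S = U w" "card (children w) \<ge> 2" by blast
    then have "\<not> card (children w) \<le> Suc 0" by simp
    then obtain c d where cd: "c \<in> children w" "d \<in> children w" "c \<noteq> d"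
      using card_le_Suc0_iff_eq[of "children w"] by auto
    have "\<not> E c d" using siblings_incomparable cd by (simp add: E_iff)
    moreover have "separates n E (U w) c d" using branching_separates[OF cd] by simp
    moreover have "\<not> separates n E T c d" if "T \<subset> U w" for T
    proof
      assume "separates n E T c d"
      then have "A c \<inter> A d \<subseteq> T" by (rule common_anc_subset_separator)
      then show False using that cd by (auto simp: children_def)
    qed
    ultimately show "S \<in> minimal_vertex_separators n E"
      unfolding minimal_vertex_separators_def using w cd by blast
  qed
qed

text \<open>Vertices with a single child may be added to the sum, since their multiplicity is
  0.\<close>

lemma separator_multiset:
  "(\<Sum>S\<in>minimal_vertex_separators n E. replicate_mset (sep_mult n E S) (real (card S))) =
    (\<Sum>v\<in>internal. replicate_mset (card (children v) - 1) (real (card (U v))))"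
proof -
  have "(\<Sum>S\<in>minimal_vertex_separators n E. replicate_mset (sep_mult n E S) (real (card S))) =
    (\<Sum>v | v \<in> internal \<and> card (children v) \<ge> 2. replicate_mset (card (children v) - 1) (real (card (U v))))"
    unfolding minimal_vertex_separators_eq by (simp add: sum.reindex[OF inj_on_U] sep_mult_eq)
  also have "\<dots> = (\<Sum>v\<in>internal. replicate_mset (card (children v) - 1) (real (card (U v))))"
    by (rule sum.mono_neutral_left) (auto simp: not_le)
  finally show ?thesis .
qed

end

section \<open>Quasi-threshold graphs\<close>

text \<open>Private neighbours \<open>a\<close> of \<open>u\<close> and \<open>b\<close> of
  \<open>v\<close> give the path \<open>a\<close>, \<open>u\<close>, \<open>v\<close>,
  \<open>b\<close>: an induced \<open>C4\<close> if \<open>a\<close> and \<open>b\<close> are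
  adjacent, otherwise an induced \<open>P4\<close>.\<close>

lemma quasi_threshold_nested:
  assumes g: "simple_graph n E" and qt: "quasi_threshold n E" and e: "E u v"
  shows "insert u {w. E u w} \<subseteq> insert v {w. E v w} \<or> insert v {w. E v w} \<subseteq> insert u {w. E u w}"
proof (rule ccontr)
  assume "\<not> ?thesis"
  then obtain a b where a: "a = u \<or> E u a" "a \<noteq> v" "\<not> E v a" and b: "b = v \<or> E v b" "b \<noteq> u" "\<not> E u b"
    by auto
  have sym: "E x y \<Longrightarrow> E y x" and irr: "\<not> E x x" and dom: "E x y \<Longrightarrow> x < n \<and> y < n" for x y
    using g by (auto simp: simple_graph_def)
  have ea: "E a u" "E v b" using a b e sym by auto
  have ne: "distinct [a, u, v, b]" "\<not> E a v" using a b ea e irr sym by auto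
  have V: "a \<in> verts n" "u \<in> verts n" "v \<in> verts n" "b \<in> verts n"
    using ea dom by (auto simp: verts_def)
  show False
  proof (cases "E a b")
    case True
    then have "has_induced_C4 n E"
      unfolding has_induced_C4_def using V ea ne e b sym by blast
    then show False using qt by (simp add: quasi_threshold_def)
  next
    case False
    then have "has_induced_P4 n E"
      unfolding has_induced_P4_def using V ea ne e b by blast
    then show False using qt by (simp add: quasi_threshold_def)
  qed
qed

lemma quasi_threshold_tree_order:
  assumes g: "simple_graph n E" and conn: "connected_graph n E" and qt: "quasi_threshold n E"
  obtains anc r where "tree_order n E anc r"
proof -
  define N where "N v = insert v {w. E v w}" for v
  define anc where "anc u v \<longleftrightarrow> E u v \<and> (N v \<subset> N u \<or> N v = N u \<and> u < v)" for u v
  have sym: "E x y \<Longrightarrow> E y x" and irr: "\<not> E x x" and dom: "E x y \<Longrightarrow> x < n \<and> y < n" for x y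
    using g by (auto simp: simple_graph_def)
  have comparable: "anc u v \<or> anc v u" if "E u v" for u v
  proof -
    have "u \<noteq> v" using that irr by auto
    then show ?thesis
      using quasi_threshold_nested[OF g qt that] sym[OF that] that unfolding anc_def N_def by auto
  qed
  have sub: "N v \<subseteq> N u" if "anc u v" for u v using that by (auto simp: anc_def)
  have self: "v \<in> N v" for v by (simp add: N_def)
  have trans: "anc u w" if "anc u v" "anc v w" for u v w
  proof -
    have "w \<noteq> u" using that by (auto simp: anc_def)
    moreover have "w \<in> N u" using sub that self by blast
    ultimately have "E u w" by (simp add: N_def)
    then show ?thesis using that unfolding anc_def by auto
  qed
  have chain: "a = b \<or> anc a b \<or> anc b a" if "anc a v" "anc b v" for a b v
  proof -
    have "b \<in> N v" using that sym by (simp add: anc_def N_def)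
    then have "b \<in> N a" using sub that by blast
    then show ?thesis using comparable by (auto simp: N_def)
  qed
  have "verts n \<noteq> {}" using conn by (simp add: connected_graph_def)
  then have "n > 0" by (simp add: verts_def)
  define m where "m = Max ((\<lambda>v. card (N v)) ` {..<n})"
  have "m \<in> (\<lambda>v. card (N v)) ` {..<n}"
    unfolding m_def using \<open>n > 0\<close> by (intro Max_in) auto
  then have ex: "\<exists>v. v < n \<and> card (N v) = m" by auto
  \<comment> \<open>The least index among the vertices with the largest closed neighbourhood, so
    that neither strict inclusion nor the tie-break can place a vertex above
    \<open>r\<close>.\<close>
  define r where "r = (LEAST v. v < n \<and> card (N v) = m)"
  have r: "r < n" "card (N r) = m" using LeastI_ex[OF ex] by (auto simp: r_def)
  have top: "\<not> anc u r" for u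
  proof
    assume u: "anc u r"
    then have un: "u < n" using dom by (auto simp: anc_def)
    have "finite (N u)" using finite_subset[of "N u" "{..<n}"] dom un by (auto simp: N_def)
    moreover have "card (N u) \<le> m" unfolding m_def using un by (intro Max_ge) auto
    ultimately have "N u = N r" using sub[OF u] r(2) card_seteq by metis
    then have "u < r" "card (N u) = m" using u r by (auto simp: anc_def)
    then show False using un not_less_Least[of u "\<lambda>v. v < n \<and> card (N v) = m"] by (simp add: r_def)
  qed
  \<comment> \<open>Since nothing lies above \<open>r\<close>, each neighbour \<open>x\<close> of
    \<open>r\<close> satisfies \<open>N x \<subseteq> N r\<close>. Thus \<open>N r\<close> is closed
    under adjacency, and connectedness makes it contain every vertex.\<close>
  have below_root: "anc r v" if "v < n" "v \<noteq> r" for v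
  proof -
    have "(\<lambda>x y. E x y \<and> x \<in> verts n \<and> y \<in> verts n)\<^sup>*\<^sup>* r v"
      using conn r that by (auto simp: connected_graph_def reachable_in_def verts_def)
    then have "v \<in> N r"
    proof (induction rule: rtranclp_induct)
      case (step x y)
      show ?case
      proof (cases "x = r")
        case False
        then have "E r x" using step.IH by (simp add: N_def)
        then have "N x \<subseteq> N r" using comparable top sub by blast
        then show ?thesis using step.hyps by (auto simp: N_def)
      qed (use step in \<open>auto simp: N_def\<close>)
    qed (rule self)
    then have "E r v" using that by (simp add: N_def)
    then show ?thesis using comparable top by blast
  qed
  have "tree_order n E anc r"
  proof
    show "E u v \<longleftrightarrow> anc u v \<or> anc v u" for u v
      using comparable[of u v] sym[of v u] unfolding anc_def by blast
    show "\<not> anc v v" for v using irr by (simp add: anc_def)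
    show "anc u v \<Longrightarrow> u < n \<and> v < n" for u v using dom by (auto simp: anc_def)
  qed (use trans chain r below_root in blast)+
  then show thesis using that by blast
qed

theorem theorem7:
  fixes n :: nat and E :: "nat \<Rightarrow> nat \<Rightarrow> bool"
  assumes "simple_graph n E"
    and "connected_graph n E"
    and "quasi_threshold n E"
  shows "nonzero_laplacian_spectrum n E =
      image_mset (\<lambda>v. real (degree n E v + 1))
                 (mset_set {v \<in> verts n. \<not> simplicial n E v})
    + (\<Sum>Q \<in> maximal_cliques n E. replicate_mset (card (Simp n E Q) - 1) (real (card Q)))
    + (\<Sum>S \<in> minimal_vertex_separators n E. replicate_mset (sep_mult n E S) (real (card S)))"
proof -
  obtain anc r where "tree_order n E anc r"
    using quasi_threshold_tree_order[OF assms] by blast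
  then interpret tree_order n E anc r .
  show ?thesis
    unfolding nonzero_laplacian_spectrum_eq degree_multiset_internal separator_multiset ..
qed

end
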